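(* There is an algorithm that, given a graph $G$ of order $n$, enumerates all globally minimal defensive alliances of $G$ in time $\mathcal{O}^*(2^n)$. This is optimal, even on very restricted graphs: there is an infinite family of graphs, each of which is a complete bipartite graph with pathwidth $2$, treewidth $2$, neighborhood diversity $2$, vertex cover number $2$, cliquewidth $2$ (i.e., it is a cograph), twin-cover number $2$ and treedepth $3$, such that the number of globally minimal defensive alliances of a member of order $n$ is at least $2^n/p(n)$ for some fixed polynomial $p$ (so that every enumeration algorithm needs at least this many steps).
   Context: Graphs are finite, simple and undirected. For $G=(V,E)$, $X\subseteq V$ and $v\in V$, $\deg_X(v)$ is the number of neighbors of $v$ in $X$, and $\overline{X}=V\setminus X$. A set $A\subseteq V$ is a defensive alliance if $\deg_A(v)+1\ge \deg_{\overline{A}}(v)$ for every $v\in A$. A non-empty defensive alliance is globally minimal if no proper subset of it is a non-empty defensive alliance. $\mathcal{O}^*$ suppresses factors polynomial in $n$. Neighborhood diversity: the number of equivalence classes of the relation on $V$ where $u,v$ are equivalent iff $N(v)\setminus\{u\}=N(u)\setminus\{v\}$. Twin-cover number: the minimum size of a set $X\subseteq V$ such that for every edge $\{u,v\}$, either $u\in X$ or $v\in X$ or $N[u]=N[v]$. Treedepth: the minimum depth (maximum number of vertices on a root-to-leaf path) of a rooted forest $F$ on vertex set $V$ such that for every edge $\{u,v\}$ of $G$ one of $u,v$ is an ancestor of the other in $F$. Vertex cover number: minimum size of a vertex cover. Pathwidth, treewidth and cliquewidth are standard. *)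

theory Defs
  imports "Graph_Theory.Graph_Theory" "HOL-Computational_Algebra.Polynomial"
begin

text \<open>
  A finite simple undirected graph is a pair digraph \<open>G\<close> with \<open>pair_graph G\<close>: finite vertex set
  \<open>pverts G\<close>, and \<open>parcs G\<close> is a symmetric irreflexive relation on it. An undirected edge
  \<open>{u, v}\<close> is present as both \<open>(u, v)\<close> and \<open>(v, u)\<close>.
\<close>

abbreviation graph_order :: "'a pair_pre_digraph \<Rightarrow> nat" where
  "graph_order G \<equiv> card (pverts G)"

definition nbhd :: "'a pair_pre_digraph \<Rightarrow> 'a \<Rightarrow> 'a set" where
  "nbhd G v = {u. (v, u) \<in> parcs G}"

definition closed_nbhd :: "'a pair_pre_digraph \<Rightarrow> 'a \<Rightarrow> 'a set" where
  "closed_nbhd G v = insert v (nbhd G v)"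

definition deg_in :: "'a pair_pre_digraph \<Rightarrow> 'a set \<Rightarrow> 'a \<Rightarrow> nat" where
  "deg_in G X v = card (nbhd G v \<inter> X)"


section \<open>Defensive alliances\<close>

definition defensive_alliance :: "'a pair_pre_digraph \<Rightarrow> 'a set \<Rightarrow> bool" where
  "defensive_alliance G A \<longleftrightarrow>
     A \<subseteq> pverts G \<and> (\<forall>v\<in>A. deg_in G A v + 1 \<ge> deg_in G (pverts G - A) v)"

definition globally_minimal_defensive_alliance :: "'a pair_pre_digraph \<Rightarrow> 'a set \<Rightarrow> bool" where
  "globally_minimal_defensive_alliance G A \<longleftrightarrow>
     defensive_alliance G A \<and> A \<noteq> {} \<and> \<not> (\<exists>B. B \<subset> A \<and> B \<noteq> {} \<and> defensive_alliance G B)"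

definition gmdas :: "'a pair_pre_digraph \<Rightarrow> 'a set set" where
  "gmdas G = {A. globally_minimal_defensive_alliance G A}"


section \<open>Graph classes and structural parameters\<close>

definition complete_bipartite :: "'a pair_pre_digraph \<Rightarrow> bool" where
  "complete_bipartite G \<longleftrightarrow>
     (\<exists>a b. a > 0 \<and> b > 0 \<and> complete_bipartite_digraph a b (with_proj G))"

definition graph_complement :: "'a pair_pre_digraph \<Rightarrow> 'a pair_pre_digraph" where
  "graph_complement G = \<lparr> pverts = pverts G,
     parcs = {(u, v). u \<in> pverts G \<and> v \<in> pverts G \<and> u \<noteq> v \<and> (u, v) \<notin> parcs G} \<rparr>"

inductive cograph :: "'a pair_pre_digraph \<Rightarrow> bool" where
  cograph_vertex: "cograph \<lparr> pverts = {v}, parcs = {} \<rparr>"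
| cograph_union: "cograph G \<Longrightarrow> cograph H \<Longrightarrow> pverts G \<inter> pverts H = {} \<Longrightarrow>
    cograph \<lparr> pverts = pverts G \<union> pverts H, parcs = parcs G \<union> parcs H \<rparr>"
| cograph_complement: "cograph G \<Longrightarrow> cograph (graph_complement G)"

definition neighborhood_diversity :: "'a pair_pre_digraph \<Rightarrow> nat" where
  "neighborhood_diversity G =
     card (pverts G // {(u, v). u \<in> pverts G \<and> v \<in> pverts G \<and> nbhd G v - {u} = nbhd G u - {v}})"

definition vertex_cover :: "'a pair_pre_digraph \<Rightarrow> 'a set \<Rightarrow> bool" where
  "vertex_cover G X \<longleftrightarrow> X \<subseteq> pverts G \<and> (\<forall>(u, v)\<in>parcs G. u \<in> X \<or> v \<in> X)"

definition vertex_cover_number :: "'a pair_pre_digraph \<Rightarrow> nat" where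
  "vertex_cover_number G = (LEAST k. \<exists>X. vertex_cover G X \<and> card X = k)"

definition twin_cover :: "'a pair_pre_digraph \<Rightarrow> 'a set \<Rightarrow> bool" where
  "twin_cover G X \<longleftrightarrow> X \<subseteq> pverts G \<and>
     (\<forall>(u, v)\<in>parcs G. u \<in> X \<or> v \<in> X \<or> closed_nbhd G u = closed_nbhd G v)"

definition twin_cover_number :: "'a pair_pre_digraph \<Rightarrow> nat" where
  "twin_cover_number G = (LEAST k. \<exists>X. twin_cover G X \<and> card X = k)"

text \<open>
  A rooted forest on \<open>V\<close> is given by its parent function; roots are the vertices without parent.
\<close>

definition parent_rel :: "('a \<Rightarrow> 'a option) \<Rightarrow> 'a rel" where
  "parent_rel par = {(v, u). par v = Some u}"

definition rooted_forest :: "'a set \<Rightarrow> ('a \<Rightarrow> 'a option) \<Rightarrow> bool" where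
  "rooted_forest V par \<longleftrightarrow> dom par \<subseteq> V \<and> ran par \<subseteq> V \<and> acyclic (parent_rel par)"

text \<open>
  \<open>forest_depth_le V par d\<close>: every path from a root to a leaf \<open>v\<close> has at most \<open>d\<close> vertices; the
  vertices of that path are \<open>v\<close> and its ancestors.
\<close>

definition forest_depth_le :: "'a set \<Rightarrow> ('a \<Rightarrow> 'a option) \<Rightarrow> nat \<Rightarrow> bool" where
  "forest_depth_le V par d \<longleftrightarrow> (\<forall>v\<in>V - ran par. card ((parent_rel par)\<^sup>* `` {v}) \<le> d)"

definition treedepth :: "'a pair_pre_digraph \<Rightarrow> nat" where
  "treedepth G = (LEAST d. \<exists>par. rooted_forest (pverts G) par \<and>
     (\<forall>(u, v)\<in>parcs G. (u, v) \<in> (parent_rel par)\<^sup>+ \<or> (v, u) \<in> (parent_rel par)\<^sup>+) \<and>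
     forest_depth_le (pverts G) par d)"

text \<open>
  The library predicate \<open>tree\<close> is about digraphs: in a symmetric digraph every edge is already a
  cycle \<open>u, v, u\<close> in its sense, so cycles of an undirected graph are those of length at least 3.
\<close>

definition undirected_tree :: "'a pair_pre_digraph \<Rightarrow> bool" where
  "undirected_tree T \<longleftrightarrow> pair_graph T \<and> Digraph_Component.connected (with_proj T) \<and>
     \<not> (\<exists>p. pre_digraph.cycle (with_proj T) p \<and> length p \<ge> 3)"

definition tree_decomposition ::
    "'a pair_pre_digraph \<Rightarrow> nat pair_pre_digraph \<Rightarrow> (nat \<Rightarrow> 'a set) \<Rightarrow> bool" where
  "tree_decomposition G T bag \<longleftrightarrow> undirected_tree T \<and>
     (\<Union>t\<in>pverts T. bag t) = pverts G \<and>
     (\<forall>(u, v)\<in>parcs G. \<exists>t\<in>pverts T. u \<in> bag t \<and> v \<in> bag t) \<and>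
     (\<forall>v\<in>pverts G. Digraph_Component.connected (with_proj T \<restriction> {t \<in> pverts T. v \<in> bag t}))"

text \<open>
  Width is maximum bag size minus one. (For the empty graph these two definitions yield 0
  rather than -1.)
\<close>

definition treewidth :: "'a pair_pre_digraph \<Rightarrow> nat" where
  "treewidth G = (LEAST k. \<exists>T bag. tree_decomposition G T bag \<and> (\<forall>t\<in>pverts T. card (bag t) \<le> k + 1))"

definition path_decomposition :: "'a pair_pre_digraph \<Rightarrow> 'a set list \<Rightarrow> bool" where
  "path_decomposition G bags \<longleftrightarrow>
     \<Union> (set bags) = pverts G \<and>
     (\<forall>(u, v)\<in>parcs G. \<exists>X\<in>set bags. u \<in> X \<and> v \<in> X) \<and>
     (\<forall>i j k. i \<le> j \<and> j \<le> k \<and> k < length bags \<longrightarrow> bags ! i \<inter> bags ! k \<subseteq> bags ! j)"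

definition pathwidth :: "'a pair_pre_digraph \<Rightarrow> nat" where
  "pathwidth G = (LEAST k. \<exists>bags. path_decomposition G bags \<and> (\<forall>X\<in>set bags. card X \<le> k + 1))"

text \<open>
  \<open>cw_constructible k G lab\<close>: the graph \<open>G\<close> with vertex labels \<open>lab\<close> can be built with the \<open>k\<close>
  labels \<open>0, \<dots>, k - 1\<close>. Values of \<open>lab\<close> outside \<open>pverts G\<close> are irrelevant.
\<close>

inductive cw_constructible :: "nat \<Rightarrow> 'a pair_pre_digraph \<Rightarrow> ('a \<Rightarrow> nat) \<Rightarrow> bool" for k where
  cw_vertex: "i < k \<Longrightarrow> cw_constructible k \<lparr> pverts = {v}, parcs = {} \<rparr> (\<lambda>_. i)"
| cw_union: "cw_constructible k G lab \<Longrightarrow> cw_constructible k H lab' \<Longrightarrow> pverts G \<inter> pverts H = {} \<Longrightarrow>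
    cw_constructible k \<lparr> pverts = pverts G \<union> pverts H, parcs = parcs G \<union> parcs H \<rparr>
      (\<lambda>v. if v \<in> pverts G then lab v else lab' v)"
| cw_join: "cw_constructible k G lab \<Longrightarrow> i < k \<Longrightarrow> j < k \<Longrightarrow> i \<noteq> j \<Longrightarrow>
    cw_constructible k \<lparr> pverts = pverts G, parcs = parcs G \<union>
      {(u, v). u \<in> pverts G \<and> v \<in> pverts G \<and> {lab u, lab v} = {i, j}} \<rparr> lab"
| cw_relabel: "cw_constructible k G lab \<Longrightarrow> i < k \<Longrightarrow> j < k \<Longrightarrow>
    cw_constructible k G (\<lambda>v. if lab v = i then j else lab v)"

definition cliquewidth :: "'a pair_pre_digraph \<Rightarrow> nat" where
  "cliquewidth G = (LEAST k. \<exists>lab. cw_constructible k G lab)"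


section \<open>Algorithms\<close>

text \<open>
  Programs for a successor random access machine with structured control: registers, a memory of
  natural numbers with indirect addressing, and a write-only output. Every instruction and every
  test takes one step. The only arithmetic is increment and decrement by one, so after \<open>t\<close> steps
  all numbers are at most \<open>t\<close> plus the largest number in the input and the program; therefore unit
  cost agrees with logarithmic cost up to a factor \<open>O(log t)\<close> for inputs of order at most \<open>t\<close>.
\<close>

datatype com =
    Const nat nat
  | Copy nat nat
  | Inc nat
  | Dec nat
  | Load nat nat
  | Store nat nat
  | Output nat
  | Seq com com
  | Cond nat com com
  | While nat com

record state =
  regs :: "nat \<Rightarrow> nat"
  mem :: "nat \<Rightarrow> nat"
  out :: "nat list"

definition set_reg :: "nat \<Rightarrow> nat \<Rightarrow> state \<Rightarrow> state" where
  "set_reg r x s = s\<lparr> regs := (regs s)(r := x) \<rparr>"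

text \<open>\<open>exec c s t s'\<close>: started in state \<open>s\<close>, program \<open>c\<close> halts after \<open>t\<close> steps in state \<open>s'\<close>.\<close>

inductive exec :: "com \<Rightarrow> state \<Rightarrow> nat \<Rightarrow> state \<Rightarrow> bool" where
  exec_Const: "exec (Const r x) s 1 (set_reg r x s)"
| exec_Copy: "exec (Copy r a) s 1 (set_reg r (regs s a) s)"
| exec_Inc: "exec (Inc r) s 1 (set_reg r (regs s r + 1) s)"
| exec_Dec: "exec (Dec r) s 1 (set_reg r (regs s r - 1) s)"
| exec_Load: "exec (Load r a) s 1 (set_reg r (mem s (regs s a)) s)"
| exec_Store: "exec (Store a r) s 1 (s\<lparr> mem := (mem s)(regs s a := regs s r) \<rparr>)"
| exec_Output: "exec (Output r) s 1 (s\<lparr> out := out s @ [regs s r] \<rparr>)"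
| exec_Seq: "exec c s t s' \<Longrightarrow> exec d s' t' s'' \<Longrightarrow> exec (Seq c d) s (t + t') s''"
| exec_CondTrue: "regs s r \<noteq> 0 \<Longrightarrow> exec c s t s' \<Longrightarrow> exec (Cond r c d) s (1 + t) s'"
| exec_CondFalse: "regs s r = 0 \<Longrightarrow> exec d s t s' \<Longrightarrow> exec (Cond r c d) s (1 + t) s'"
| exec_WhileFalse: "regs s r = 0 \<Longrightarrow> exec (While r c) s 1 s"
| exec_WhileTrue: "regs s r \<noteq> 0 \<Longrightarrow> exec c s t s' \<Longrightarrow> exec (While r c) s' t' s'' \<Longrightarrow>
    exec (While r c) s (1 + t + t') s''"

text \<open>
  Inputs are graphs with vertex set \<open>{..<n}\<close>. Register 0 holds \<open>n\<close>, and cell \<open>i * n + j\<close> of the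
  memory holds the entry of the adjacency matrix for \<open>i, j < n\<close>; everything else is zero.
\<close>

definition input_state :: "nat pair_pre_digraph \<Rightarrow> state" where
  "input_state G = \<lparr> regs = (\<lambda>_. 0)(0 := graph_order G),
     mem = (\<lambda>a. if a < graph_order G * graph_order G \<and>
                    (a div graph_order G, a mod graph_order G) \<in> parcs G then 1 else 0),
     out = [] \<rparr>"

definition char_vector :: "nat \<Rightarrow> nat set \<Rightarrow> nat list" where
  "char_vector n A = map (\<lambda>i. if i \<in> A then 1 else 0) [0..<n]"

text \<open>
  The output word \<open>w\<close> lists the characteristic vectors of all globally minimal defensive alliances
  of \<open>G\<close>, each exactly once, in some order.
\<close>

definition enumerates_gmdas :: "nat pair_pre_digraph \<Rightarrow> nat list \<Rightarrow> bool" where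
  "enumerates_gmdas G w \<longleftrightarrow>
     (\<exists>As. distinct As \<and> set As = gmdas G \<and> w = concat (map (char_vector (graph_order G)) As))"

end

theory Submission
  imports Defs "HOL-Library.Nat_Bijection"
begin

text \<open>
  Upper bound: defensive alliances are closed under union, so every vertex set \<open>B\<close> contains a largest
  one, which is reached by repeatedly expelling the vertices that violate the alliance condition. A
  non-empty set \<open>A\<close> is a globally minimal defensive alliance iff it is its own largest alliance and,
  for every \<open>v \<in> A\<close>, the largest alliance in \<open>A - {v}\<close> is empty. The program runs this polynomial
  test on all subsets, which it traverses with a binary counter.

  Lower bound: in the complete bipartite graph with sides \<open>X\<close> of size 2 and \<open>Y\<close> of size \<open>2 * k\<close>, every
  non-empty alliance meets \<open>X\<close> and has at least \<open>k\<close> vertices in \<open>Y\<close>. Hence one vertex of \<open>X\<close> together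
  with any \<open>k\<close> vertices of \<open>Y\<close> is globally minimal, which yields \<open>2 * (2 * k choose k)\<close> of them.
\<close>

section \<open>Running programs\<close>

text \<open>With increment and decrement as the only arithmetic, no address is computed directly:
  loops drag along pointers into the adjacency matrix and the two vectors, and a degree condition is
  decided by counting up and down in one register. \<open>runs\<close> treats time as a budget, so
  that branches of different cost share one bound and sequences add up. A round of expulsions that
  does not end in an alliance has removed a vertex, so \<open>n\<close> rounds reach the largest
  alliance; the test of one set costs a polynomial of degree 4, and the exponential factor comes
  only from the \<open>2 ^ n\<close> values of the counter. In a complete bipartite graph, a vertex
  needs floor(s / 2) allies on an opposite side of size s. For s = 2 this is one, so no alliance
  lives inside \<open>Y\<close>; with a single vertex in \<open>X\<close> it would be zero, and
  single vertices of \<open>Y\<close> would already be alliances. For s = \<open>2 * k\<close> it is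
  \<open>k\<close>, the middle level of the subsets of \<open>Y\<close>, whose size is smaller than
  \<open>2 ^ (2 * k)\<close> only by a polynomial factor.\<close>

definition runs :: "com \<Rightarrow> state \<Rightarrow> nat \<Rightarrow> (state \<Rightarrow> bool) \<Rightarrow> bool" where
  "runs c s T Q \<longleftrightarrow> (\<exists>t s'. exec c s t s' \<and> t \<le> T \<and> Q s')"

lemma runs_mono: "runs c s T Q \<Longrightarrow> T \<le> T' \<Longrightarrow> (\<And>s'. Q s' \<Longrightarrow> Q' s') \<Longrightarrow> runs c s T' Q'"
  unfolding runs_def by (meson order_trans)

primrec writes :: "com \<Rightarrow> nat set" where
  "writes (Const r x) = {r}"
| "writes (Copy r a) = {r}"
| "writes (Inc r) = {r}"
| "writes (Dec r) = {r}"
| "writes (Load r a) = {r}"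
| "writes (Store a r) = {}"
| "writes (Output r) = {}"
| "writes (Seq c d) = writes c \<union> writes d"
| "writes (Cond r c d) = writes c \<union> writes d"
| "writes (While r c) = writes c"

primrec stores :: "com \<Rightarrow> bool" where
  "stores (Const r x) = False"
| "stores (Copy r a) = False"
| "stores (Inc r) = False"
| "stores (Dec r) = False"
| "stores (Load r a) = False"
| "stores (Store a r) = True"
| "stores (Output r) = False"
| "stores (Seq c d) = (stores c \<or> stores d)"
| "stores (Cond r c d) = (stores c \<or> stores d)"
| "stores (While r c) = stores c"

primrec prints :: "com \<Rightarrow> bool" where
  "prints (Const r x) = False"
| "prints (Copy r a) = False"
| "prints (Inc r) = False"
| "prints (Dec r) = False"
| "prints (Load r a) = False"
| "prints (Store a r) = False"
| "prints (Output r) = True"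
| "prints (Seq c d) = (prints c \<or> prints d)"
| "prints (Cond r c d) = (prints c \<or> prints d)"
| "prints (While r c) = prints c"

text \<open>A frame condition read off the program text. It spares the loop invariants from listing
  everything that a loop body leaves alone.\<close>

definition same :: "com \<Rightarrow> state \<Rightarrow> state \<Rightarrow> bool" where
  "same c s s' \<longleftrightarrow> (\<forall>q. q \<notin> writes c \<longrightarrow> regs s' q = regs s q) \<and>
     (\<not> stores c \<longrightarrow> mem s' = mem s) \<and> (\<not> prints c \<longrightarrow> out s' = out s)"

lemma same_regs: "same c s s' \<Longrightarrow> q \<notin> writes c \<Longrightarrow> regs s' q = regs s q"
  and same_mem: "same c s s' \<Longrightarrow> \<not> stores c \<Longrightarrow> mem s' = mem s"
  and same_out: "same c s s' \<Longrightarrow> \<not> prints c \<Longrightarrow> out s' = out s"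
  by (simp_all add: same_def)

lemma same_trans: "same c s s' \<Longrightarrow> same c s' s'' \<Longrightarrow> same c s s''"
  by (simp add: same_def)

lemma exec_same: "exec c s t s' \<Longrightarrow> same c s s'"
  by (induction rule: exec.induct) (auto simp: same_def set_reg_def)

primrec flat :: "com \<Rightarrow> bool" where
  "flat (Const r x) = True"
| "flat (Copy r a) = True"
| "flat (Inc r) = True"
| "flat (Dec r) = True"
| "flat (Load r a) = True"
| "flat (Store a r) = True"
| "flat (Output r) = True"
| "flat (Seq c d) = (flat c \<and> flat d)"
| "flat (Cond r c d) = (flat c \<and> flat d)"
| "flat (While r c) = False"

text \<open>A functional semantics lets the simplifier execute loop-free code symbolically; the
  values of \<open>sem\<close> and \<open>cost\<close> at \<open>While\<close> are dummies, ruled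
  out by \<open>flat\<close>.\<close>

primrec sem :: "com \<Rightarrow> state \<Rightarrow> state" where
  "sem (Const r x) s = set_reg r x s"
| "sem (Copy r a) s = set_reg r (regs s a) s"
| "sem (Inc r) s = set_reg r (regs s r + 1) s"
| "sem (Dec r) s = set_reg r (regs s r - 1) s"
| "sem (Load r a) s = set_reg r (mem s (regs s a)) s"
| "sem (Store a r) s = s\<lparr>mem := (mem s)(regs s a := regs s r)\<rparr>"
| "sem (Output r) s = s\<lparr>out := out s @ [regs s r]\<rparr>"
| "sem (Seq c d) s = sem d (sem c s)"
| "sem (Cond r c d) s = (if regs s r \<noteq> 0 then sem c s else sem d s)"
| "sem (While r c) s = s"

primrec cost :: "com \<Rightarrow> nat" where
  "cost (Const r x) = 1"
| "cost (Copy r a) = 1"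
| "cost (Inc r) = 1"
| "cost (Dec r) = 1"
| "cost (Load r a) = 1"
| "cost (Store a r) = 1"
| "cost (Output r) = 1"
| "cost (Seq c d) = cost c + cost d"
| "cost (Cond r c d) = 1 + max (cost c) (cost d)"
| "cost (While r c) = 0"

lemma exec_sem: "flat c \<Longrightarrow> \<exists>t\<le>cost c. exec c s t (sem c s)"
proof (induction c arbitrary: s)
  case (Seq c d)
  then obtain t t' where "t \<le> cost c" "exec c s t (sem c s)"
    "t' \<le> cost d" "exec d (sem c s) t' (sem d (sem c s))" by fastforce
  then show ?case by (intro exI[of _ "t + t'"]) (auto intro: exec_Seq)
next
  case (Cond r c d)
  show ?case
  proof (cases "regs s r = 0")
    case True
    obtain t where "t \<le> cost d" "exec d s t (sem d s)" using Cond by fastforce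
    then have "exec (Cond r c d) s (1 + t) (sem d s)" using True by (intro exec_CondFalse)
    then show ?thesis using True \<open>t \<le> cost d\<close> by (intro exI[of _ "1 + t"]) simp
  next
    case False
    obtain t where "t \<le> cost c" "exec c s t (sem c s)" using Cond by fastforce
    then have "exec (Cond r c d) s (1 + t) (sem c s)" using False by (intro exec_CondTrue)
    then show ?thesis using False \<open>t \<le> cost c\<close> by (intro exI[of _ "1 + t"]) simp
  qed
qed (auto intro!: exI[of _ "Suc 0"] exec_Const[simplified] exec_Copy[simplified] exec_Inc[simplified]
    exec_Dec[simplified] exec_Load[simplified] exec_Store[simplified] exec_Output[simplified])

lemma runs_flat: "flat c \<Longrightarrow> cost c \<le> T \<Longrightarrow> Q (sem c s) \<Longrightarrow> runs c s T Q"
  unfolding runs_def using exec_sem order_trans by blast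

lemma runs_Seq:
  assumes "runs c s T P" "\<And>s'. P s' \<Longrightarrow> same c s s' \<Longrightarrow> runs d s' T' Q"
  shows "runs (Seq c d) s (T + T') Q"
proof -
  obtain t s' where 1: "exec c s t s'" "t \<le> T" "P s'" using assms(1) by (auto simp: runs_def)
  then obtain t' s'' where 2: "exec d s' t' s''" "t' \<le> T'" "Q s''"
    using assms(2) exec_same by (auto simp: runs_def) blast
  show ?thesis
    unfolding runs_def using 1 2 exec_Seq add_mono by blast
qed

lemma runs_Seq_flat:
  "flat c \<Longrightarrow> runs d (sem c s) T Q \<Longrightarrow> runs (Seq c d) s (cost c + T) Q"
  by (rule runs_Seq[where P = "\<lambda>s'. s' = sem c s"]) (auto intro: runs_flat)

lemma runs_frame: "runs c s T Q \<Longrightarrow> runs c s T (\<lambda>s'. Q s' \<and> same c s s')"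
  unfolding runs_def using exec_same by blast

lemma runs_WhileTrue:
  assumes "regs s r \<noteq> 0" "runs c s T P"
    and "\<And>s'. P s' \<Longrightarrow> same c s s' \<Longrightarrow> runs (While r c) s' T' Q"
  shows "runs (While r c) s (1 + T + T') Q"
proof -
  obtain t s' where 1: "exec c s t s'" "t \<le> T" "P s'" using assms(2) by (auto simp: runs_def)
  then obtain t' s'' where 2: "exec (While r c) s' t' s''" "t' \<le> T'" "Q s''"
    using assms(3) exec_same by (auto simp: runs_def) blast
  show ?thesis
    unfolding runs_def using exec_WhileTrue[OF assms(1) 1(1) 2(1)] 1(2) 2(2,3)
    by (intro exI[of _ "1 + t + t'"]) auto
qed

lemma runs_Cond:
  assumes "regs s r \<noteq> 0 \<Longrightarrow> runs c s T Q" "regs s r = 0 \<Longrightarrow> runs d s T Q"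
  shows "runs (Cond r c d) s (1 + T) Q"
  using assms unfolding runs_def
  by (cases "regs s r = 0") (meson add_left_mono exec_CondFalse exec_CondTrue)+

definition countdown :: "nat \<Rightarrow> com \<Rightarrow> com" where
  "countdown r c = While r (Seq c (Dec r))"

definition ntimes :: "nat \<Rightarrow> com \<Rightarrow> com" where
  "ntimes r c = Seq (Copy r 0) (countdown r c)"

lemma countdown_simps [simp]:
  "writes (countdown r c) = insert r (writes c)"
  "stores (countdown r c) = stores c" "prints (countdown r c) = prints c"
  by (auto simp: countdown_def)

lemma ntimes_simps [simp]:
  "writes (ntimes r c) = insert r (writes c)"
  "stores (ntimes r c) = stores c" "prints (ntimes r c) = prints c"
  by (auto simp: ntimes_def)

text \<open>\<open>I\<close> counts finished iterations and has to hold after the decrement that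
  closes an iteration, hence the \<open>set_reg\<close> in the step premise. An iteration pays
  \<open>T\<close> for the body and one step each for test and decrement; the last
  \<open>+ 1\<close> is the failing test.\<close>

lemma runs_countdown:
  assumes r: "r \<notin> writes c" "regs s r = k" and init: "I 0 s"
    and step: "\<And>i s'. i < k \<Longrightarrow> I i s' \<Longrightarrow> regs s' r = k - i \<Longrightarrow> same (countdown r c) s s' \<Longrightarrow>
      runs c s' T (\<lambda>s''. I (Suc i) (set_reg r (k - Suc i) s''))"
  shows "runs (countdown r c) s (k * (T + 2) + 1) (I k)"
proof -
  have "runs (countdown r c) s' (j * (T + 2) + 1) (I k)"
    if "j \<le> k" "I (k - j) s'" "regs s' r = j" "same (countdown r c) s s'" for j s'
    using that
  proof (induction j arbitrary: s')
    case 0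
    then show ?case
      unfolding runs_def countdown_def by (auto intro!: exI[of _ s'] exI[of _ 1] exec_WhileFalse)
  next
    case (Suc j)
    have "k - Suc j < k" "k - Suc (k - Suc j) = j" "Suc (k - Suc j) = k - j" "k - (k - Suc j) = Suc j"
      using Suc.prems(1) by auto
    then have "runs c s' T (\<lambda>s''. I (k - j) (set_reg r j s''))"
      using step[of "k - Suc j" s'] Suc.prems by simp
    then obtain t s'' where c: "exec c s' t s''" "t \<le> T" "I (k - j) (set_reg r j s'')"
      by (auto simp: runs_def)
    have "regs s'' r = Suc j"
      using exec_same[OF c(1)] r(1) Suc.prems(3) by (simp add: same_regs)
    then have body: "exec (Seq c (Dec r)) s' (t + 1) (set_reg r j s'')"
      using exec_Seq[OF c(1) exec_Dec[of r s'']] by simp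
    have "same (countdown r c) s s'" by (rule Suc.prems(4))
    moreover have "same (countdown r c) s' (set_reg r j s'')"
      using exec_same[OF body] by (simp add: same_def)
    ultimately have "same (countdown r c) s (set_reg r j s'')" by (rule same_trans)
    moreover have "regs (set_reg r j s'') r = j" by (simp add: set_reg_def)
    ultimately obtain t' u where u: "exec (countdown r c) (set_reg r j s'') t' u"
      "t' \<le> j * (T + 2) + 1" "I k u"
      using Suc.IH[of "set_reg r j s''"] c(3) Suc.prems(1) by (auto simp: runs_def)
    have "exec (countdown r c) s' (1 + (t + 1) + t') u"
      using u(1) Suc.prems(3) unfolding countdown_def
      by (intro exec_WhileTrue[OF _ body]) auto
    moreover have "1 + (t + 1) + t' \<le> Suc j * (T + 2) + 1" using c(2) u(2) by simp
    ultimately show ?case using u(3) unfolding runs_def by blast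
  qed
  from this[of k s] show ?thesis using r(2) init by (simp add: same_def)
qed

lemma runs_ntimes:
  assumes r: "r \<notin> writes c" "regs s 0 = n" and init: "I 0 (set_reg r n s)"
    and step: "\<And>i s'. i < n \<Longrightarrow> I i s' \<Longrightarrow> same (ntimes r c) s s' \<Longrightarrow>
      runs c s' T (\<lambda>s''. I (Suc i) (set_reg r (n - Suc i) s''))"
  shows "runs (ntimes r c) s (n * (T + 2) + 2) (I n)"
proof -
  have "runs (countdown r c) (set_reg r n s) (n * (T + 2) + 1) (I n)"
  proof (rule runs_countdown[OF r(1)])
    fix i s' assume "i < n" "I i s'" "same (countdown r c) (set_reg r n s) s'"
    moreover from this have "same (ntimes r c) s s'" by (simp add: same_def set_reg_def)
    ultimately show "runs c s' T (\<lambda>s''. I (Suc i) (set_reg r (n - Suc i) s''))"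
      using step by blast
  qed (use init in \<open>simp_all add: set_reg_def\<close>)
  then have "runs (ntimes r c) s (cost (Copy r 0) + (n * (T + 2) + 1)) (I n)"
    unfolding ntimes_def by (intro runs_Seq_flat) (simp_all add: r(2))
  then show ?thesis by simp
qed

abbreviation Seq_infix :: "com \<Rightarrow> com \<Rightarrow> com" (infixr ";;" 60) where
  "c ;; d \<equiv> Seq c d"

text \<open>Binary increment: the trailing ones \<open>{..<i}\<close> have total weight
  \<open>2 ^ i - 1\<close>, so adding one trades them for the first zero \<open>i\<close>.\<close>

lemma set_encode_carry:
  assumes "finite A" "{..<i} \<subseteq> A" "i \<notin> A"
  shows "set_encode (insert i (A - {..<i})) = Suc (set_encode A)"
proof -
  have split: "A = {..<i} \<union> (A - {..<i})" using assms(2) by auto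
  have "set_encode A = (\<Sum>j<i. 2 ^ j) + set_encode (A - {..<i})"
    unfolding set_encode_def using assms(1)
    by (subst split, subst sum.union_disjoint) auto
  moreover have "(\<Sum>j<i. 2 ^ j) = (2::nat) ^ i - 1" by (induction i) auto
  moreover have "set_encode (insert i (A - {..<i})) = 2 ^ i + set_encode (A - {..<i})"
    using assms by (simp add: set_encode_insert)
  ultimately show ?thesis by simp
qed

section \<open>Largest alliances\<close>

definition secure :: "nat pair_pre_digraph \<Rightarrow> nat set \<Rightarrow> nat \<Rightarrow> bool" where
  "secure G B u \<longleftrightarrow> deg_in G (pverts G - B) u \<le> deg_in G B u + 1"

definition expel :: "nat pair_pre_digraph \<Rightarrow> nat \<Rightarrow> nat set \<Rightarrow> nat set" where
  "expel G u B = (if secure G B u then B else B - {u})"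

definition largest_alliance :: "nat pair_pre_digraph \<Rightarrow> nat set \<Rightarrow> nat set \<Rightarrow> bool" where
  "largest_alliance G B L \<longleftrightarrow> defensive_alliance G L \<and> L \<subseteq> B \<and>
     (\<forall>C\<subseteq>B. defensive_alliance G C \<longrightarrow> C \<subseteq> L)"

lemma defensive_alliance_iff_secure:
  "defensive_alliance G B \<longleftrightarrow> B \<subseteq> pverts G \<and> (\<forall>u\<in>B. secure G B u)"
  by (simp add: defensive_alliance_def secure_def)

text \<open>Enlarging the set only moves neighbours from outside to inside. By contraposition, a
  vertex that is insecure in \<open>B\<close> belongs to no alliance inside \<open>B\<close> and can
  be expelled without losing one.\<close>

lemma secure_mono:
  assumes "finite (nbhd G u)" "C \<subseteq> B" "secure G C u"
  shows "secure G B u"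
proof -
  have "card (nbhd G u \<inter> C) \<le> card (nbhd G u \<inter> B)"
    "card (nbhd G u \<inter> (pverts G - B)) \<le> card (nbhd G u \<inter> (pverts G - C))"
    using assms(1,2) by (auto intro!: card_mono)
  then show ?thesis using assms(3) by (simp add: secure_def deg_in_def)
qed

text \<open>A proper sub-alliance misses some \<open>v\<close> in \<open>A\<close>, hence lies in
  \<open>L v\<close>. The point \<open>v0\<close> outside \<open>A\<close> turns the alliance test
  into an instance of the same scheme: \<open>A - {v0} = A\<close>, and
  \<open>A \<subseteq> L v0\<close> says that \<open>A\<close> is its own largest alliance.\<close>

lemma gmda_iff_largest_alliance:
  assumes "A \<subseteq> pverts G" "A \<noteq> {}" "v0 \<notin> A" "v0 \<in> S" "A \<subseteq> S"
    and L: "\<And>v. v \<in> S \<Longrightarrow> largest_alliance G (A - {v}) (L v)"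
  shows "A \<in> gmdas G \<longleftrightarrow> (\<forall>v\<in>S. (v \<in> A \<longrightarrow> L v = {}) \<and> (v \<notin> A \<longrightarrow> A \<subseteq> L v))"
proof
  assume A: "A \<in> gmdas G"
  show "\<forall>v\<in>S. (v \<in> A \<longrightarrow> L v = {}) \<and> (v \<notin> A \<longrightarrow> A \<subseteq> L v)"
  proof (intro ballI conjI impI)
    fix v assume v: "v \<in> S" "v \<in> A"
    then have "L v \<subset> A" "defensive_alliance G (L v)"
      using L[OF v(1)] by (auto simp: largest_alliance_def)
    then show "L v = {}"
      using A by (auto simp: gmdas_def globally_minimal_defensive_alliance_def)
  next
    fix v assume "v \<in> S" "v \<notin> A"
    then show "A \<subseteq> L v"
      using L[of v] A
      by (auto simp: largest_alliance_def gmdas_def globally_minimal_defensive_alliance_def)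
  qed
next
  assume *: "\<forall>v\<in>S. (v \<in> A \<longrightarrow> L v = {}) \<and> (v \<notin> A \<longrightarrow> A \<subseteq> L v)"
  have "L v0 = A"
    using * L[OF assms(4)] assms(3,4) by (auto simp: largest_alliance_def)
  then have "defensive_alliance G A" using L[OF assms(4)] by (simp add: largest_alliance_def)
  moreover have "B = {}" if B: "B \<subset> A" "defensive_alliance G B" for B
  proof -
    obtain v where v: "v \<in> A" "v \<notin> B" using B(1) by blast
    then have "B \<subseteq> A - {v}" using B by auto
    moreover have "v \<in> S" using v assms(5) by auto
    ultimately have "B \<subseteq> L v" using L[of v] B(2) by (auto simp: largest_alliance_def)
    then show ?thesis using * v \<open>v \<in> S\<close> by auto
  qed
  ultimately show "A \<in> gmdas G"
    using assms(2) by (auto simp: gmdas_def globally_minimal_defensive_alliance_def)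
qed

text \<open>The half of \<open>largest_alliance\<close> that already holds before an alliance is
  reached; being transitive, it composes over repeated passes.\<close>

definition keeps_alliances :: "nat pair_pre_digraph \<Rightarrow> nat set \<Rightarrow> nat set \<Rightarrow> bool" where
  "keeps_alliances G B L \<longleftrightarrow> L \<subseteq> B \<and> (\<forall>C\<subseteq>B. defensive_alliance G C \<longrightarrow> C \<subseteq> L)"

lemma keeps_alliances_trans:
  "keeps_alliances G B B' \<Longrightarrow> keeps_alliances G B' B'' \<Longrightarrow> keeps_alliances G B B''"
  by (auto simp: keeps_alliances_def)

lemma largest_alliance_iff_keeps:
  "largest_alliance G B L \<longleftrightarrow> defensive_alliance G L \<and> keeps_alliances G B L"
  by (auto simp: largest_alliance_def keeps_alliances_def)

section \<open>The enumeration program\<close>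

locale layout =
  fixes G :: "nat pair_pre_digraph" and n a b :: nat
  assumes graph: "pair_graph G" and verts: "pverts G = {..<n}"
    and a: "a = n * n" and b: "b = n * n + n + 1"
begin

text \<open>The entire memory as a function of the two sets. The last region is unbounded, so that
  the zero memory behind the input matrix is exactly that of \<open>cells {} {}\<close>.\<close>

definition cells :: "nat set \<Rightarrow> nat set \<Rightarrow> nat \<Rightarrow> nat" where
  "cells A B x = (if x < a then of_bool ((x div n, x mod n) \<in> parcs G)
     else if x < b then of_bool (x - a \<in> A) else of_bool (x - b \<in> B))"

lemma b_eq: "b = Suc (a + n)"
  by (simp add: a b)

lemma cells_adj: "u < n \<Longrightarrow> w < n \<Longrightarrow> cells A B (u * n + w) = of_bool ((u, w) \<in> parcs G)"
proof -
  assume uw: "u < n" "w < n"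
  have "u * n + w < Suc u * n" using uw(2) by simp
  also have "\<dots> \<le> n * n" using uw(1) by (intro mult_right_mono) auto
  finally have "u * n + w < a" by (simp add: a)
  then show ?thesis using uw by (simp add: cells_def)
qed

lemma cells_A: "i \<le> n \<Longrightarrow> cells A B (a + i) = of_bool (i \<in> A)"
  unfolding cells_def by (simp add: b_eq)

lemma cells_B: "cells A B (b + i) = of_bool (i \<in> B)"
  unfolding cells_def by (simp add: b_eq)

lemma update_A:
  "i \<le> n \<Longrightarrow> (cells A B)(a + i := 0) = cells (A - {i}) B"
  "i \<le> n \<Longrightarrow> (cells A B)(a + i := Suc 0) = cells (insert i A) B"
  unfolding cells_def by (auto simp: b_eq fun_eq_iff)

lemma update_B:
  "(cells A B)(b + i := 0) = cells A (B - {i})"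
  "(cells A B)(b + i := of_bool P) = cells A (if P then insert i B else B - {i})"
  unfolding cells_def by (auto simp: b_eq fun_eq_iff)

definition ready :: "state \<Rightarrow> bool" where
  "ready s \<longleftrightarrow> regs s 0 = n \<and> regs s 1 = a \<and> regs s 2 = b \<and> regs s 12 = 0 \<and> regs s 13 = 1"

lemma readyD:
  assumes "ready s"
  shows "regs s 0 = n" "regs s (Suc 0) = a" "regs s 2 = b" "regs s 12 = 0" "regs s 13 = Suc 0"
  using assms by (simp_all add: ready_def)

lemma same_ready:
  "same c s s' \<Longrightarrow> ready s \<Longrightarrow> {0, 1, 2, 12, 13} \<inter> writes c = {} \<Longrightarrow> ready s'"
  by (simp add: ready_def same_def)

lemma ready_set_reg: "ready s \<Longrightarrow> r \<notin> {0, 1, 2, 12, 13} \<Longrightarrow> ready (set_reg r x s)"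
  by (auto simp: ready_def set_reg_def)

end

text \<open>
  Register 0 holds \<open>n\<close>, registers 1 and 2 hold the base addresses \<open>a\<close> and \<open>b\<close> of the characteristic
  vectors of the current set \<open>A\<close> and of a working copy; both vectors have a cell for the non-vertex
  \<open>n\<close>. Registers 12 and 13 hold the constants 0 and 1, register 3 is the flag of the main loop,
  register 4 is the carry of the binary counter \<open>A\<close>, and register 5 says whether \<open>A\<close> has passed all
  tests so far. \<open>Copy 14 14\<close> serves as a no-op.
\<close>

definition increment_body :: com where
  "increment_body = Load 14 8 ;; Cond 4 (Cond 14 (Store 8 12) (Store 8 13 ;; Const 4 0)) (Copy 14 14) ;; Inc 8"

definition increment :: com where
  "increment = (Const 4 1 ;; Copy 8 1) ;; ntimes 10 increment_body"

definition copy_set :: com where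
  "copy_set = (Copy 8 1 ;; Copy 9 2) ;;
     ntimes 10 (Load 14 8 ;; Store 9 14 ;; Inc 8 ;; Inc 9)"

definition count_body :: com where
  "count_body = Load 20 16 ;; Load 21 9 ;; Cond 20 (Cond 21 (Inc 18) (Dec 18)) (Copy 14 14) ;; Inc 16 ;; Inc 9"

text \<open>
  Starting register 18 at \<open>n + 2\<close> keeps the truncated decrements exact; after \<open>n\<close> more of them it is
  non-zero iff the vertex has at most one more neighbour outside than inside.
\<close>

definition expel_step :: com where
  "expel_step = (Copy 18 0 ;; Inc 18 ;; Inc 18 ;; Copy 9 2) ;; ntimes 19 count_body ;;
     ntimes 19 (Dec 18) ;; Cond 18 (Copy 14 14) (Store 15 12) ;; Inc 15"

text \<open>Register 15 points to the cell of the current vertex in the working copy. Register 16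
  runs once through the whole adjacency matrix: rows are stored consecutively, so it is not reset
  between vertices.\<close>

definition expel_pass :: com where
  "expel_pass = (Copy 15 2 ;; Const 16 0) ;; ntimes 17 expel_step"

definition peel :: com where
  "peel = ntimes 10 expel_pass"

text \<open>Register 23 tells whether the removed point lies in \<open>A\<close>, and thus which
  clause of \<open>gmda_iff_largest_alliance\<close> applies: if it does, any vertex left clears
  register 5; if not, any missing vertex of \<open>A\<close> does.\<close>

definition compare_body :: com where
  "compare_body = Load 14 8 ;; Load 21 9 ;;
     Cond 23 (Cond 21 (Const 5 0) (Copy 14 14)) (Cond 14 (Cond 21 (Copy 14 14) (Const 5 0)) (Copy 14 14)) ;;
     Inc 8 ;; Inc 9"

definition compare :: com where
  "compare = (Load 23 22 ;; Copy 8 1 ;; Copy 9 2) ;; ntimes 10 compare_body"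

text \<open>
  For \<open>v = n\<close> nothing is removed, so that this round tests whether \<open>A\<close> itself is an alliance.
\<close>

definition try_removal :: com where
  "try_removal = copy_set ;; Store 7 12 ;; peel ;; compare ;; Inc 7 ;; Inc 22"

definition print_set :: com where
  "print_set = Copy 8 1 ;; ntimes 10 (Load 14 8 ;; Output 14 ;; Inc 8)"

text \<open>\<open>Inc 6\<close> provides \<open>n + 1\<close> rounds, the last one for the
  non-vertex \<open>n\<close>. Registers 7 and 22 follow the cells of the point under removal in the
  working copy and in \<open>A\<close>.\<close>

definition process_set :: com where
  "process_set = (Const 5 1 ;; Copy 7 2 ;; Copy 22 1 ;; Copy 6 0 ;; Inc 6) ;;
     countdown 6 try_removal ;; Cond 5 print_set (Copy 14 14)"

text \<open>The counter advances before the test, so the empty set, which is no candidate, is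
  skipped; the carry that leaves the full set ends the loop.\<close>

definition enumerate_sets :: com where
  "enumerate_sets = While 3 (increment ;; Cond 4 (Const 3 0) process_set)"

definition initialise :: com where
  "initialise = ntimes 10 (ntimes 11 (Inc 1)) ;; Copy 2 1 ;; ntimes 10 (Inc 2) ;; Inc 2 ;; Const 13 1 ;; Const 3 1"

definition gmda_program :: com where
  "gmda_program = initialise ;; enumerate_sets"

section \<open>Correctness and running time of the program\<close>

context layout
begin

lemma finite_nbhd: "finite (nbhd G u)"
proof (rule finite_subset)
  interpret pair_graph G by (rule graph)
  show "nbhd G u \<subseteq> pverts G" using in_arcsD2 by (auto simp: nbhd_def)
qed (simp add: verts)

lemma runs_increment:
  assumes s: "ready s" "mem s = cells A B" and A: "A \<subseteq> {..<n}"
  shows "runs increment s (n * 8 + 4) (\<lambda>s'. \<exists>A'. A' \<subseteq> {..<n} \<and> mem s' = cells A' B \<and>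
    (if regs s' 4 = 0 then set_encode A' = Suc (set_encode A) else A = {..<n}))"
proof -
  have finA: "finite A" using A finite_subset by blast
  let ?s = "sem (Const 4 1 ;; Copy 8 1) s"
  \<comment> \<open>Until the carry is absorbed, the first \<open>i\<close> bits were all ones and
    are now cleared; afterwards the memory already holds the successor. A carry that survives all
    \<open>n\<close> rounds means that \<open>A\<close> was full.\<close>
  define I where "I i s' \<longleftrightarrow> regs s' 8 = a + i \<and>
    (if regs s' 4 = 0
     then \<exists>A'. A' \<subseteq> {..<n} \<and> mem s' = cells A' B \<and> set_encode A' = Suc (set_encode A) \<and> A' \<inter> {i..} = A \<inter> {i..}
     else {..<i} \<subseteq> A \<and> mem s' = cells (A - {..<i}) B)" for i and s' :: state
  have "runs (ntimes 10 increment_body) ?s (n * (6 + 2) + 2) (I n)"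
  proof (rule runs_ntimes)
    show "10 \<notin> writes increment_body" by (simp add: increment_body_def)
    show "regs ?s 0 = n" using readyD[OF s(1)] by (simp add: set_reg_def)
    show "I 0 (set_reg 10 n ?s)" using s readyD[OF s(1)] by (simp add: I_def set_reg_def)
    fix i s' assume i: "i < n" and I: "I i s'" and same: "same (ntimes 10 increment_body) ?s s'"
    have r: "regs s' 12 = 0" "regs s' 13 = Suc 0"
      using same_regs[OF same] readyD[OF s(1)] by (simp_all add: increment_body_def set_reg_def)
    show "runs increment_body s' 6 (\<lambda>s''. I (Suc i) (set_reg 10 (n - Suc i) s''))"
    proof (cases "regs s' 4 = 0")
      case True
      with I obtain A' where A': "A' \<subseteq> {..<n}" "mem s' = cells A' B"
        "set_encode A' = Suc (set_encode A)" "A' \<inter> {i..} = A \<inter> {i..}" by (auto simp: I_def)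
      have "X \<inter> {Suc i..} = X \<inter> {i..} \<inter> {Suc i..}" for X :: "nat set" by auto
      then have "A' \<inter> {Suc i..} = A \<inter> {Suc i..}" using A'(4) by metis
      with True I A' show ?thesis
        unfolding increment_body_def by (intro runs_flat) (simp, simp, auto simp: I_def set_reg_def intro!: exI[of _ A'])
    next
      case False
      then have 8: "regs s' 8 = a + i" and sub: "{..<i} \<subseteq> A" and m: "mem s' = cells (A - {..<i}) B"
        using I by (simp_all add: I_def)
      have ld: "mem s' (a + i) = of_bool (i \<in> A)" using i m by (simp add: cells_A)
      show ?thesis
      proof (cases "i \<in> A")
        case True
        have "A - {..<i} - {i} = A - {..<Suc i}" "{..<Suc i} \<subseteq> A"
          using True sub by (auto simp: lessThan_Suc)
        then show ?thesis
          unfolding increment_body_def using True False 8 ld r i m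
          by (intro runs_flat) (simp_all add: I_def set_reg_def update_A)
      next
        case iA: False
        let ?A = "insert i (A - {..<i})"
        have "?A \<subseteq> {..<n}" "?A \<inter> {Suc i..} = A \<inter> {Suc i..}" "set_encode ?A = Suc (set_encode A)"
          using A i set_encode_carry[OF finA sub iA] by auto
        then show ?thesis
          unfolding increment_body_def using iA False 8 ld r i m
          by (intro runs_flat) (auto simp: I_def set_reg_def update_A intro!: exI[of _ ?A])
      qed
    qed
  qed
  then have "runs increment s (cost (Const 4 1 ;; Copy 8 1) + (n * (6 + 2) + 2)) (I n)"
    unfolding increment_def by (intro runs_Seq_flat) auto
  then show ?thesis
  proof (rule runs_mono)
    fix s' assume "I n s'"
    then show "\<exists>A'. A' \<subseteq> {..<n} \<and> mem s' = cells A' B \<and>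
      (if regs s' 4 = 0 then set_encode A' = Suc (set_encode A) else A = {..<n})"
      using A by (auto simp: I_def split: if_splits)
  qed simp
qed

lemma runs_copy_set:
  assumes s: "ready s" "mem s = cells A B" and AB: "A \<subseteq> {..<n}" "B \<subseteq> {..<n}"
  shows "runs copy_set s (n * 6 + 4) (\<lambda>s'. mem s' = cells A A)"
proof -
  let ?c = "Load 14 8 ;; Store 9 14 ;; Inc 8 ;; Inc 9"
  let ?s = "sem (Copy 8 1 ;; Copy 9 2) s"
  define I where "I i s' \<longleftrightarrow> regs s' 8 = a + i \<and> regs s' 9 = b + i \<and>
    mem s' = cells A (A \<inter> {..<i} \<union> B \<inter> {i..})" for i and s' :: state
  have "runs (ntimes 10 ?c) ?s (n * (4 + 2) + 2) (I n)"
  proof (rule runs_ntimes)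
    show "10 \<notin> writes ?c" by simp
    show "regs ?s 0 = n" using readyD[OF s(1)] by (simp add: set_reg_def)
    show "I 0 (set_reg 10 n ?s)" using s readyD[OF s(1)] by (simp add: I_def set_reg_def)
    fix i s' assume i: "i < n" and I: "I i s'"
    have "(if i \<in> A then insert i (A \<inter> {..<i} \<union> B \<inter> {i..}) else A \<inter> {..<i} \<union> B \<inter> {i..} - {i}) =
        A \<inter> {..<Suc i} \<union> B \<inter> {Suc i..}"
      by (auto simp: less_Suc_eq Suc_le_eq le_less)
    then show "runs ?c s' 4 (\<lambda>s''. I (Suc i) (set_reg 10 (n - Suc i) s''))"
      using i I by (intro runs_flat) (simp_all add: I_def set_reg_def cells_A update_B)
  qed
  then have "runs copy_set s (cost (Copy 8 1 ;; Copy 9 2) + (n * (4 + 2) + 2)) (I n)"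
    unfolding copy_set_def by (intro runs_Seq_flat) auto
  moreover have "A \<inter> {..<n} \<union> B \<inter> {n..} = A" using AB by auto
  ultimately show ?thesis
    by (elim runs_mono) (auto simp: I_def)
qed

text \<open>The difference of the two degrees may be negative; register 18 keeps it shifted by
  \<open>n + 2\<close>, and the additive equation avoids truncated subtraction.\<close>

lemma runs_count:
  assumes s: "ready s" "mem s = cells A B" "regs s 16 = u * n" "regs s 18 = Suc (Suc n)" "regs s 9 = b"
    and u: "u < n"
  shows "runs (ntimes 19 count_body) s (n * 9 + 2) (\<lambda>s'. regs s' 16 = Suc u * n \<and>
    regs s' 18 + deg_in G (pverts G - B) u = Suc (Suc n) + deg_in G B u)"
proof -
  define I where "I i s' \<longleftrightarrow> regs s' 16 = u * n + i \<and> regs s' 9 = b + i \<and>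
    regs s' 18 + card (nbhd G u \<inter> ({..<i} - B)) = Suc (Suc n) + card (nbhd G u \<inter> ({..<i} \<inter> B))" for i and s' :: state
  have "runs (ntimes 19 count_body) s (n * (7 + 2) + 2) (I n)"
  proof (rule runs_ntimes)
    show "19 \<notin> writes count_body" by (simp add: count_body_def)
    show "regs s 0 = n" using readyD[OF s(1)] by simp
    show "I 0 (set_reg 19 n s)" using s by (simp add: I_def set_reg_def)
    fix i s' assume i: "i < n" and I: "I i s'" and same: "same (ntimes 19 count_body) s s'"
    have m: "mem s' = cells A B"
      using same_mem[OF same] s(2) by (simp add: count_body_def)
    have split: "nbhd G u \<inter> ({..<Suc i} - B) = (if (u, i) \<in> parcs G \<and> i \<notin> B
        then insert i (nbhd G u \<inter> ({..<i} - B)) else nbhd G u \<inter> ({..<i} - B))"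
      "nbhd G u \<inter> ({..<Suc i} \<inter> B) = (if (u, i) \<in> parcs G \<and> i \<in> B
        then insert i (nbhd G u \<inter> ({..<i} \<inter> B)) else nbhd G u \<inter> ({..<i} \<inter> B))"
      by (auto simp: nbhd_def less_Suc_eq)
    \<comment> \<open>At most \<open>i < n\<close> decrements have happened, so the register is
      still positive and the next \<open>Dec\<close> is exact.\<close>
    have "card (nbhd G u \<inter> ({..<i} - B)) \<le> card {..<i}" by (intro card_mono) auto
    then have "0 < regs s' 18" using I i by (simp add: I_def)
    then show "runs count_body s' 7 (\<lambda>s''. I (Suc i) (set_reg 19 (n - Suc i) s''))"
      unfolding count_body_def
      using i I m u by (intro runs_flat) (simp_all add: I_def set_reg_def cells_adj cells_B split)
  qed
  moreover have "nbhd G u \<inter> ({..<n} - B) = nbhd G u \<inter> (pverts G - B)"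
    "nbhd G u \<inter> ({..<n} \<inter> B) = nbhd G u \<inter> B"
  proof -
    interpret pair_graph G by (rule graph)
    have "nbhd G u \<subseteq> {..<n}" using in_arcsD2 verts by (auto simp: nbhd_def)
    then show "nbhd G u \<inter> ({..<n} - B) = nbhd G u \<inter> (pverts G - B)"
      "nbhd G u \<inter> ({..<n} \<inter> B) = nbhd G u \<inter> B" using verts by auto
  qed
  ultimately show ?thesis
    by (elim runs_mono) (auto simp: I_def deg_in_def)
qed

lemma runs_expel_step:
  assumes s: "ready s" "mem s = cells A B" "regs s 15 = b + u" "regs s 16 = u * n" and u: "u < n"
  shows "runs expel_step s (n * 12 + 11) (\<lambda>s'. regs s' 15 = b + Suc u \<and> regs s' 16 = Suc u * n \<and>
    mem s' = cells A (expel G u B))"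
proof -
  let ?s = "sem (Copy 18 0 ;; Inc 18 ;; Inc 18 ;; Copy 9 2) s"
  have count: "runs (ntimes 19 count_body) ?s (n * 9 + 2) (\<lambda>s'. regs s' 16 = Suc u * n \<and>
      regs s' 18 + deg_in G (pverts G - B) u = Suc (Suc n) + deg_in G B u)"
    by (rule runs_count[where A = A])
      (use s readyD[OF s(1)] u in \<open>simp_all add: set_reg_def ready_def\<close>)
  have "runs (ntimes 19 count_body ;; ntimes 19 (Dec 18) ;; Cond 18 (Copy 14 14) (Store 15 12) ;; Inc 15) ?s
      (n * 9 + 2 + ((n * (1 + 2) + 2) + 3)) (\<lambda>s'. regs s' 15 = b + Suc u \<and> regs s' 16 = Suc u * n \<and>
    mem s' = cells A (expel G u B))"
  proof (rule runs_Seq[OF count])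
    fix s1 assume c: "regs s1 16 = Suc u * n \<and>
        regs s1 18 + deg_in G (pverts G - B) u = Suc (Suc n) + deg_in G B u"
      and same1: "same (ntimes 19 count_body) ?s s1"
    have r1: "regs s1 0 = n" "regs s1 12 = 0" "regs s1 15 = b + u" "mem s1 = cells A B"
      using same_regs[OF same1] same_mem[OF same1] s readyD[OF s(1)]
      by (simp_all add: count_body_def set_reg_def)
    define I where "I i s' \<longleftrightarrow> regs s' 18 = regs s1 18 - i" for i and s' :: state
    have "runs (ntimes 19 (Dec 18)) s1 (n * (1 + 2) + 2) (I n)"
      by (rule runs_ntimes) (use r1 in \<open>auto simp: I_def set_reg_def intro!: runs_flat\<close>)
    then show "runs (ntimes 19 (Dec 18) ;; Cond 18 (Copy 14 14) (Store 15 12) ;; Inc 15) s1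
      (n * (1 + 2) + 2 + 3) (\<lambda>s'. regs s' 15 = b + Suc u \<and> regs s' 16 = Suc u * n \<and>
        mem s' = cells A (expel G u B))"
    proof (rule runs_Seq)
      fix s2 assume "I n s2" and same2: "same (ntimes 19 (Dec 18)) s1 s2"
      then have "regs s2 18 = regs s1 18 - n" by (simp add: I_def)
      moreover have "secure G B u \<longleftrightarrow> regs s1 18 - n \<noteq> 0" using c by (auto simp: secure_def)
      moreover have "regs s2 12 = 0" "regs s2 15 = b + u" "regs s2 16 = Suc u * n" "mem s2 = cells A B"
        using same_regs[OF same2] same_mem[OF same2] r1 c by simp_all
      ultimately show "runs (Cond 18 (Copy 14 14) (Store 15 12) ;; Inc 15) s2 3
        (\<lambda>s'. regs s' 15 = b + Suc u \<and> regs s' 16 = Suc u * n \<and> mem s' = cells A (expel G u B))"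
        by (intro runs_flat) (auto simp: set_reg_def expel_def update_B)
    qed
  qed
  then have "runs expel_step s (cost (Copy 18 0 ;; Inc 18 ;; Inc 18 ;; Copy 9 2) +
      (n * 9 + 2 + ((n * (1 + 2) + 2) + 3))) (\<lambda>s'. regs s' 15 = b + Suc u \<and> regs s' 16 = Suc u * n \<and>
        mem s' = cells A (expel G u B))"
    unfolding expel_step_def by (intro runs_Seq_flat) auto
  then show ?thesis by (rule runs_mono) auto
qed

lemma alliance_subset_expel:
  assumes "C \<subseteq> B" "defensive_alliance G C"
  shows "C \<subseteq> expel G u B"
  using assms secure_mono[OF finite_nbhd assms(1)]
  by (auto simp: expel_def defensive_alliance_iff_secure)

text \<open>If the pass expels nobody, every vertex was tested against the unchanged
  \<open>B\<close>, which is then an alliance; otherwise the set has shrunk. One pass is not enough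
  in general, since an expulsion can make vertices insecure that were tested before.\<close>

lemma runs_expel_pass:
  assumes s: "ready s" "mem s = cells A B" and B: "B \<subseteq> {..<n}"
  shows "runs expel_pass s (n * (n * 12 + 13) + 4) (\<lambda>s'. \<exists>B'. mem s' = cells A B' \<and>
    keeps_alliances G B B' \<and> (defensive_alliance G B' \<or> B' \<subset> B))"
proof -
  let ?s = "sem (Copy 15 2 ;; Const 16 0) s"
  define P where "P i B' \<longleftrightarrow> keeps_alliances G B B' \<and>
    (B' = B \<and> (\<forall>u\<in>B. u < i \<longrightarrow> secure G B u) \<or> B' \<subset> B)" for i B'
  define I where "I i s' \<longleftrightarrow> regs s' 15 = b + i \<and> regs s' 16 = i * n \<and>
    (\<exists>B'. mem s' = cells A B' \<and> P i B')" for i and s' :: state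
  have "runs (ntimes 17 expel_step) ?s (n * ((n * 12 + 11) + 2) + 2) (I n)"
  proof (rule runs_ntimes)
    show "17 \<notin> writes expel_step" by (simp add: expel_step_def count_body_def)
    show "regs ?s 0 = n" using readyD[OF s(1)] by (simp add: set_reg_def)
    have "P 0 B" by (simp add: P_def keeps_alliances_def)
    then show "I 0 (set_reg 17 n ?s)" using s(2) readyD[OF s(1)] by (auto simp: I_def set_reg_def)
    fix i s' assume i: "i < n" and I: "I i s'" and same: "same (ntimes 17 expel_step) ?s s'"
    have "ready ?s" using s(1) by (simp add: ready_set_reg)
    then have "ready s'"
      by (rule same_ready[OF same]) (simp add: expel_step_def count_body_def)
    obtain B' where B': "mem s' = cells A B'" "P i B'"
      using I by (auto simp: I_def)
    have "keeps_alliances G B (expel G i B')"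
      using B'(2) alliance_subset_expel[of _ B' i] by (auto simp: P_def keeps_alliances_def expel_def)
    moreover have "expel G i B' = B \<and> (\<forall>u\<in>B. u < Suc i \<longrightarrow> secure G B u) \<or> expel G i B' \<subset> B"
      using B'(2) by (auto simp: P_def expel_def less_Suc_eq)
    ultimately have P: "P (Suc i) (expel G i B')" by (simp add: P_def)
    show "runs expel_step s' (n * 12 + 11) (\<lambda>s''. I (Suc i) (set_reg 17 (n - Suc i) s''))"
    proof (rule runs_mono[OF runs_expel_step])
      show "ready s'" "mem s' = cells A B'" "regs s' 15 = b + i" "regs s' 16 = i * n" "i < n"
        using \<open>ready s'\<close> B' I i by (simp_all add: I_def)
      fix s'' :: state assume "regs s'' 15 = b + Suc i \<and> regs s'' 16 = Suc i * n \<and> mem s'' = cells A (expel G i B')"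
      then show "I (Suc i) (set_reg 17 (n - Suc i) s'')"
        using P by (auto simp: I_def set_reg_def)
    qed simp
  qed
  then have "runs expel_pass s (cost (Copy 15 2 ;; Const 16 0) + (n * ((n * 12 + 11) + 2) + 2)) (I n)"
    unfolding expel_pass_def by (intro runs_Seq_flat) auto
  then show ?thesis
  proof (rule runs_mono)
    fix s' :: state assume "I n s'"
    then obtain B' where B': "mem s' = cells A B'" "P n B'" by (auto simp: I_def)
    then have "defensive_alliance G B' \<or> B' \<subset> B"
      using B verts by (auto simp: P_def defensive_alliance_iff_secure)
    then show "\<exists>B'. mem s' = cells A B' \<and> keeps_alliances G B B' \<and> (defensive_alliance G B' \<or> B' \<subset> B)"
      using B' by (auto simp: P_def)
  qed (simp add: algebra_simps)
qed

text \<open>Each pass that does not reach an alliance costs at least one vertex; after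
  \<open>n\<close> of them nothing is left, and the empty set is an alliance.\<close>

lemma runs_peel:
  assumes s: "ready s" "mem s = cells A B" and B: "B \<subseteq> {..<n}"
  shows "runs peel s (n * (n * (n * 12 + 13) + 6) + 2) (\<lambda>s'. \<exists>L. largest_alliance G B L \<and> mem s' = cells A L)"
proof -
  define P where "P j B' \<longleftrightarrow> keeps_alliances G B B' \<and> (defensive_alliance G B' \<or> card B' + j \<le> n)" for j B'
  define I where "I j s' \<longleftrightarrow> (\<exists>B'. mem s' = cells A B' \<and> P j B')" for j and s' :: state
  have "card B \<le> n" using card_mono[OF _ B] by simp
  have "runs peel s (n * ((n * (n * 12 + 13) + 4) + 2) + 2) (I n)"
    unfolding peel_def
  proof (rule runs_ntimes)
    show "10 \<notin> writes expel_pass" by (simp add: expel_pass_def expel_step_def count_body_def)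
    show "regs s 0 = n" using readyD[OF s(1)] by simp
    have "P 0 B" using \<open>card B \<le> n\<close> by (simp add: P_def keeps_alliances_def)
    then show "I 0 (set_reg 10 n s)" using s by (auto simp: I_def set_reg_def)
    fix j s' assume j: "j < n" and I: "I j s'" and same: "same (ntimes 10 expel_pass) s s'"
    have "ready s'"
      by (rule same_ready[OF same s(1)]) (simp add: expel_pass_def expel_step_def count_body_def)
    obtain B' where B': "mem s' = cells A B'" "P j B'" using I by (auto simp: I_def)
    have "B' \<subseteq> B" using B'(2) by (simp add: P_def keeps_alliances_def)
    show "runs expel_pass s' (n * (n * 12 + 13) + 4) (\<lambda>s''. I (Suc j) (set_reg 10 (n - Suc j) s''))"
    proof (rule runs_mono[OF runs_expel_pass])
      show "ready s'" "mem s' = cells A B'" "B' \<subseteq> {..<n}"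
        using \<open>ready s'\<close> B'(1) \<open>B' \<subseteq> B\<close> B by auto
      fix s'' :: state assume "\<exists>B''. mem s'' = cells A B'' \<and> keeps_alliances G B' B'' \<and>
        (defensive_alliance G B'' \<or> B'' \<subset> B')"
      then obtain B'' where B'': "mem s'' = cells A B''" "keeps_alliances G B' B''"
        "defensive_alliance G B'' \<or> B'' \<subset> B'" by blast
      have "finite B'" by (rule finite_subset[OF order_trans[OF \<open>B' \<subseteq> B\<close> B]]) simp
      have "defensive_alliance G B'' \<or> card B'' + Suc j \<le> n"
      proof (cases "defensive_alliance G B'")
        case True
        \<comment> \<open>An alliance is kept by its own pass, so once reached it no longer
          changes.\<close>
        then have "B' \<subseteq> B''" "B'' \<subseteq> B'" using B''(2) by (simp_all add: keeps_alliances_def)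
        then have "B'' = B'" by simp
        with True show ?thesis by simp
      next
        case False
        then have "card B' + j \<le> n" using B'(2) by (simp add: P_def)
        then show ?thesis using B''(3) psubset_card_mono[OF \<open>finite B'\<close>, of B''] by fastforce
      qed
      then have "P (Suc j) B''"
        using B'(2) keeps_alliances_trans[OF _ B''(2)] by (simp add: P_def)
      then show "I (Suc j) (set_reg 10 (n - Suc j) s'')"
        using B''(1) by (auto simp: I_def set_reg_def)
    qed simp
  qed
  then show ?thesis
  proof (rule runs_mono)
    fix s' :: state assume "I n s'"
    then obtain L where L: "mem s' = cells A L" "P n L" by (auto simp: I_def)
    have "L \<subseteq> B" using L(2) by (simp add: P_def keeps_alliances_def)
    \<comment> \<open>Finiteness is what turns \<open>card L + n \<le> n\<close> into
      \<open>L = {}\<close>.\<close>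
    then have "finite L" using finite_subset[OF order_trans[OF _ B]] by simp
    then have "defensive_alliance G L" using L(2) by (auto simp: P_def defensive_alliance_def)
    then show "\<exists>L. largest_alliance G B L \<and> mem s' = cells A L"
      using L by (auto simp: P_def largest_alliance_iff_keeps)
  qed simp
qed

lemma runs_compare:
  assumes s: "ready s" "mem s = cells A L" "regs s 22 = a + v" and v: "v \<le> n"
    and sub: "A \<subseteq> {..<n}" "L \<subseteq> {..<n}"
  shows "runs compare s (n * 10 + 5) (\<lambda>s'. regs s' 5 \<noteq> 0 \<longleftrightarrow>
    regs s 5 \<noteq> 0 \<and> (v \<in> A \<longrightarrow> L = {}) \<and> (v \<notin> A \<longrightarrow> A \<subseteq> L))"
proof -
  let ?s = "sem (Load 23 22 ;; Copy 8 1 ;; Copy 9 2) s"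
  define I where "I i s' \<longleftrightarrow> regs s' 8 = a + i \<and> regs s' 9 = b + i \<and>
    (regs s' 5 \<noteq> 0 \<longleftrightarrow> regs s 5 \<noteq> 0 \<and> (\<forall>w<i. (v \<in> A \<longrightarrow> w \<notin> L) \<and> (v \<notin> A \<longrightarrow> w \<in> A \<longrightarrow> w \<in> L)))"
    for i and s' :: state
  have "runs (ntimes 10 compare_body) ?s (n * (8 + 2) + 2) (I n)"
  proof (rule runs_ntimes)
    show "10 \<notin> writes compare_body" by (simp add: compare_body_def)
    show "regs ?s 0 = n" using readyD[OF s(1)] by (simp add: set_reg_def)
    show "I 0 (set_reg 10 n ?s)" using s readyD[OF s(1)] by (simp add: I_def set_reg_def)
    fix i s' assume i: "i < n" and I: "I i s'" and same: "same (ntimes 10 compare_body) ?s s'"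
    have "regs s' 23 = of_bool (v \<in> A)" "mem s' = cells A L"
      using same_regs[OF same, of 23] same_mem[OF same] s v
      by (simp_all add: compare_body_def set_reg_def cells_A)
    then show "runs compare_body s' 8 (\<lambda>s''. I (Suc i) (set_reg 10 (n - Suc i) s''))"
      unfolding compare_body_def
      using i I by (intro runs_flat) (auto simp: I_def set_reg_def cells_A cells_B less_Suc_eq)
  qed
  then have "runs compare s (cost (Load 23 22 ;; Copy 8 1 ;; Copy 9 2) + (n * (8 + 2) + 2)) (I n)"
    unfolding compare_def by (intro runs_Seq_flat) auto
  then show ?thesis
  proof (rule runs_mono)
    fix s' :: state assume "I n s'"
    moreover have "L = {} \<longleftrightarrow> (\<forall>w<n. w \<notin> L)" "A \<subseteq> L \<longleftrightarrow> (\<forall>w<n. w \<in> A \<longrightarrow> w \<in> L)"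
      using sub by auto
    ultimately show "regs s' 5 \<noteq> 0 \<longleftrightarrow>
      regs s 5 \<noteq> 0 \<and> (v \<in> A \<longrightarrow> L = {}) \<and> (v \<notin> A \<longrightarrow> A \<subseteq> L)"
      unfolding I_def by blast
  qed simp
qed

lemma writes_peel: "writes peel = {9, 10, 14, 15, 16, 17, 18, 19, 20, 21}"
  by (auto simp: peel_def expel_pass_def expel_step_def count_body_def)

lemma writes_try_removal: "writes try_removal = {5, 7, 8, 9, 10, 14, 15, 16, 17, 18, 19, 20, 21, 22, 23}"
  by (auto simp: try_removal_def writes_peel copy_set_def compare_def compare_body_def)

lemma runs_try_removal:
  assumes s: "ready s" "mem s = cells A B" "regs s 7 = b + v" "regs s 22 = a + v" and v: "v \<le> n"
    and sub: "A \<subseteq> {..<n}" "B \<subseteq> {..<n}"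
  shows "runs try_removal s (n * (n * (n * 12 + 13) + 22) + 14) (\<lambda>s'. \<exists>L. largest_alliance G (A - {v}) L \<and>
    mem s' = cells A L \<and> regs s' 7 = b + Suc v \<and> regs s' 22 = a + Suc v \<and>
    (regs s' 5 \<noteq> 0 \<longleftrightarrow> regs s 5 \<noteq> 0 \<and> (v \<in> A \<longrightarrow> L = {}) \<and> (v \<notin> A \<longrightarrow> A \<subseteq> L)))"
    (is "runs _ _ _ ?Q")
proof -
  have "runs try_removal s ((n * 6 + 4) + (cost (Store 7 12) +
      ((n * (n * (n * 12 + 13) + 6) + 2) + ((n * 10 + 5) + 2)))) ?Q"
    unfolding try_removal_def
  proof (rule runs_Seq[OF runs_copy_set[OF s(1,2) sub]], rule runs_Seq_flat, simp)
    fix s1 :: state assume m: "mem s1 = cells A A" and same1: "same copy_set s s1"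
    have "ready s1" by (rule same_ready[OF same1 s(1)]) (simp add: copy_set_def)
    have r1: "regs s1 7 = b + v" "regs s1 22 = a + v" "regs s1 5 = regs s 5"
      using same_regs[OF same1] s by (simp_all add: copy_set_def)
    let ?s1 = "sem (Store 7 12) s1"
    have ms1: "mem ?s1 = cells A (A - {v})" "ready ?s1"
      using m r1 \<open>ready s1\<close> readyD[OF \<open>ready s1\<close>] by (simp_all add: update_B ready_def)
    have "A - {v} \<subseteq> {..<n}" using sub by auto
    from runs_peel[OF ms1(2,1) this]
    show "runs (peel ;; compare ;; Inc 7 ;; Inc 22) ?s1
      ((n * (n * (n * 12 + 13) + 6) + 2) + ((n * 10 + 5) + 2)) ?Q"
    proof (rule runs_Seq)
      fix s2 :: state assume "\<exists>L. largest_alliance G (A - {v}) L \<and> mem s2 = cells A L"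
        and same2: "same peel ?s1 s2"
      then obtain L where L: "largest_alliance G (A - {v}) L" "mem s2 = cells A L" by blast
      have "ready s2" by (rule same_ready[OF same2 ms1(2)]) (simp add: writes_peel)
      have r2: "regs s2 7 = b + v" "regs s2 22 = a + v" "regs s2 5 = regs s 5"
        using same_regs[OF same2] r1 by (simp_all add: writes_peel)
      have "L \<subseteq> {..<n}" using L(1) sub by (auto simp: largest_alliance_def)
      from runs_compare[OF \<open>ready s2\<close> L(2) r2(2) v sub(1) this]
      show "runs (compare ;; Inc 7 ;; Inc 22) s2 ((n * 10 + 5) + 2) ?Q"
      proof (rule runs_Seq)
        fix s3 :: state assume c: "regs s3 5 \<noteq> 0 \<longleftrightarrow>
            regs s2 5 \<noteq> 0 \<and> (v \<in> A \<longrightarrow> L = {}) \<and> (v \<notin> A \<longrightarrow> A \<subseteq> L)"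
          and same3: "same compare s2 s3"
        have "regs s3 7 = b + v" "regs s3 22 = a + v" "mem s3 = cells A L"
          using same_regs[OF same3] same_mem[OF same3] r2 L(2)
          by (simp_all add: compare_def compare_body_def)
        then show "runs (Inc 7 ;; Inc 22) s3 2 ?Q"
          using c L(1) r2(3) by (intro runs_flat) (auto simp: set_reg_def)
      qed
    qed
  qed
  then show ?thesis by (rule runs_mono) (simp_all add: algebra_simps)
qed

lemma runs_print_set:
  assumes s: "ready s" "mem s = cells A B"
  shows "runs print_set s (n * 5 + 3) (\<lambda>s'. out s' = out s @ char_vector n A)"
proof -
  let ?s = "sem (Copy 8 1) s" and ?c = "Load 14 8 ;; Output 14 ;; Inc 8"
  define I where "I i s' \<longleftrightarrow> regs s' 8 = a + i \<and> out s' = out s @ char_vector i A" for i and s' :: state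
  have "runs (ntimes 10 ?c) ?s (n * (3 + 2) + 2) (I n)"
  proof (rule runs_ntimes)
    show "10 \<notin> writes ?c" by simp
    show "regs ?s 0 = n" using readyD[OF s(1)] by (simp add: set_reg_def)
    show "I 0 (set_reg 10 n ?s)" using s readyD[OF s(1)] by (simp add: I_def set_reg_def char_vector_def)
    fix i s' assume i: "i < n" and I: "I i s'" and same: "same (ntimes 10 ?c) ?s s'"
    have "mem s' = cells A B" using same_mem[OF same] s by (simp add: set_reg_def)
    then show "runs ?c s' 3 (\<lambda>s''. I (Suc i) (set_reg 10 (n - Suc i) s''))"
      using i I by (intro runs_flat) (auto simp: I_def set_reg_def cells_A char_vector_def)
  qed
  then have "runs print_set s (cost (Copy 8 1) + (n * (3 + 2) + 2)) (I n)"
    unfolding print_set_def by (intro runs_Seq_flat) auto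
  then show ?thesis by (rule runs_mono) (auto simp: I_def)
qed

text \<open>\<open>n + 1\<close> rounds of \<open>try_removal\<close> with two steps of loop control
  each, then printing. The 10 is made of 5 initial steps, the last loop test, the branch, and 3
  steps of \<open>print_set\<close> outside its iterations.\<close>

definition set_time :: nat where
  "set_time = Suc n * (n * (n * (n * 12 + 13) + 22) + 16) + n * 5 + 10"

lemma runs_process_set:
  assumes s: "ready s" "mem s = cells A B" and sub: "A \<subseteq> {..<n}" "B \<subseteq> {..<n}" and ne: "A \<noteq> {}"
  shows "runs process_set s set_time (\<lambda>s'. \<exists>B'\<subseteq>{..<n}. mem s' = cells A B' \<and>
    out s' = out s @ (if A \<in> gmdas G then char_vector n A else []))" (is "runs _ _ _ ?Q")
proof -
  let ?init = "Const 5 1 ;; Copy 7 2 ;; Copy 22 1 ;; Copy 6 0 ;; Inc 6"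
  let ?s = "sem ?init s"
  define ok where "ok v L \<longleftrightarrow> (v \<in> A \<longrightarrow> L = {}) \<and> (v \<notin> A \<longrightarrow> A \<subseteq> L)" for v L
  \<comment> \<open>The largest alliances appear only during the run, so the invariant collects them
    in an existentially quantified family \<open>L\<close> that gains one value per round.\<close>
  define I where "I i s' \<longleftrightarrow> regs s' 7 = b + i \<and> regs s' 22 = a + i \<and>
    (\<exists>B'\<subseteq>{..<n}. mem s' = cells A B') \<and>
    (\<exists>L. (\<forall>v<i. largest_alliance G (A - {v}) (L v)) \<and> (regs s' 5 \<noteq> 0 \<longleftrightarrow> (\<forall>v<i. ok v (L v))))"
    for i and s' :: state
  have "runs (countdown 6 try_removal) ?s
      (Suc n * ((n * (n * (n * 12 + 13) + 22) + 14) + 2) + 1) (I (Suc n))"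
  proof (rule runs_countdown)
    show "6 \<notin> writes try_removal" by (simp add: writes_try_removal)
    show "regs ?s 6 = Suc n" using readyD[OF s(1)] by (simp add: set_reg_def)
    show "I 0 ?s" using s(2) readyD[OF s(1)] sub by (auto simp: I_def set_reg_def)
    fix i s' assume i: "i < Suc n" and I: "I i s'" and same: "same (countdown 6 try_removal) ?s s'"
    have "ready ?s" using s(1) by (simp add: ready_set_reg)
    then have "ready s'" by (rule same_ready[OF same]) (simp add: writes_try_removal)
    obtain B' L where B': "B' \<subseteq> {..<n}" "mem s' = cells A B'"
      and L: "\<forall>v<i. largest_alliance G (A - {v}) (L v)" "regs s' 5 \<noteq> 0 \<longleftrightarrow> (\<forall>v<i. ok v (L v))"
      using I unfolding I_def by blast
    show "runs try_removal s' (n * (n * (n * 12 + 13) + 22) + 14)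
      (\<lambda>s''. I (Suc i) (set_reg 6 (Suc n - Suc i) s''))"
    proof (rule runs_mono[OF runs_try_removal])
      show "ready s'" "mem s' = cells A B'" "regs s' 7 = b + i" "regs s' 22 = a + i" "i \<le> n"
        "A \<subseteq> {..<n}" "B' \<subseteq> {..<n}"
        using \<open>ready s'\<close> B' I i sub by (simp_all add: I_def)
      fix s'' :: state assume "\<exists>L'. largest_alliance G (A - {i}) L' \<and> mem s'' = cells A L' \<and>
        regs s'' 7 = b + Suc i \<and> regs s'' 22 = a + Suc i \<and>
        (regs s'' 5 \<noteq> 0 \<longleftrightarrow> regs s' 5 \<noteq> 0 \<and> (i \<in> A \<longrightarrow> L' = {}) \<and> (i \<notin> A \<longrightarrow> A \<subseteq> L'))"
      then obtain L' where L': "largest_alliance G (A - {i}) L'" "mem s'' = cells A L'"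
        "regs s'' 7 = b + Suc i" "regs s'' 22 = a + Suc i"
        "regs s'' 5 \<noteq> 0 \<longleftrightarrow> regs s' 5 \<noteq> 0 \<and> ok i L'" unfolding ok_def by blast
      have "L' \<subseteq> {..<n}" using L'(1) sub by (auto simp: largest_alliance_def)
      then have "\<exists>B'\<subseteq>{..<n}. mem s'' = cells A B'" using L'(2) by blast
      moreover have "\<forall>v<Suc i. largest_alliance G (A - {v}) ((L(i := L')) v)"
        using L(1) L'(1) by (simp add: less_Suc_eq)
      moreover have "regs s'' 5 \<noteq> 0 \<longleftrightarrow> (\<forall>v<Suc i. ok v ((L(i := L')) v))"
        using L(2) L'(5) by (auto simp: less_Suc_eq)
      ultimately have "I (Suc i) s''"
        unfolding I_def using L'(3,4) by blast
      then show "I (Suc i) (set_reg 6 (Suc n - Suc i) s'')"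
        unfolding I_def by (simp add: set_reg_def)
    qed simp
  qed
  then have "runs (countdown 6 try_removal ;; Cond 5 print_set (Copy 14 14)) ?s
      ((Suc n * ((n * (n * (n * 12 + 13) + 22) + 14) + 2) + 1) + (1 + (n * 5 + 3))) ?Q"
  proof (rule runs_Seq)
    fix s1 :: state assume I: "I (Suc n) s1" and same1: "same (countdown 6 try_removal) ?s s1"
    have "ready ?s" using s(1) by (simp add: ready_set_reg)
    then have "ready s1" by (rule same_ready[OF same1]) (simp add: writes_try_removal)
    have out: "out s1 = out s"
      using same_out[OF same1] by (simp add: set_reg_def try_removal_def copy_set_def peel_def expel_pass_def
          expel_step_def count_body_def compare_def compare_body_def)
    obtain B' L where B': "B' \<subseteq> {..<n}" "mem s1 = cells A B'"
      and L: "\<forall>v<Suc n. largest_alliance G (A - {v}) (L v)" "regs s1 5 \<noteq> 0 \<longleftrightarrow> (\<forall>v<Suc n. ok v (L v))"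
      using I unfolding I_def by blast
    \<comment> \<open>The required point outside \<open>A\<close> is the non-vertex
      \<open>n\<close>, treated in the last of the \<open>n + 1\<close> rounds.\<close>
    have "A \<in> gmdas G \<longleftrightarrow> (\<forall>v\<in>{..<Suc n}. (v \<in> A \<longrightarrow> L v = {}) \<and> (v \<notin> A \<longrightarrow> A \<subseteq> L v))"
      by (rule gmda_iff_largest_alliance[where ?v0.0 = n]) (use sub ne L(1) verts in auto)
    then have g: "regs s1 5 \<noteq> 0 \<longleftrightarrow> A \<in> gmdas G" using L(2) by (auto simp: ok_def)
    show "runs (Cond 5 print_set (Copy 14 14)) s1 (1 + (n * 5 + 3)) ?Q"
    proof (rule runs_Cond)
      assume "regs s1 5 \<noteq> 0"
      with g have "A \<in> gmdas G" by simp
      from runs_frame[OF runs_print_set[OF \<open>ready s1\<close> B'(2)]]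
      show "runs print_set s1 (n * 5 + 3) ?Q"
      proof (rule runs_mono)
        fix s' :: state assume s': "out s' = out s1 @ char_vector n A \<and> same print_set s1 s'"
        then have "mem s' = cells A B'" using same_mem[of print_set s1 s'] B'(2) by (simp add: print_set_def)
        then show "?Q s'" using s' B'(1) out \<open>A \<in> gmdas G\<close> by auto
      qed simp
    next
      assume "regs s1 5 = 0"
      then show "runs (Copy 14 14) s1 (n * 5 + 3) ?Q"
        using g B' out by (intro runs_flat) (auto simp: set_reg_def)
    qed
  qed
  then have "runs process_set s (cost ?init +
      ((Suc n * ((n * (n * (n * 12 + 13) + 22) + 14) + 2) + 1) + (1 + (n * 5 + 3)))) ?Q"
    unfolding process_set_def by (intro runs_Seq_flat) auto
  then show ?thesis by (rule runs_mono) (simp_all add: set_time_def)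
qed

lemma runs_initialise:
  assumes s: "regs s = (\<lambda>_. 0)(0 := n)" "mem s = cells {} {}"
  shows "runs initialise s (n * (n * 3 + 7) + 8)
    (\<lambda>s'. ready s' \<and> regs s' 3 = 1 \<and> mem s' = cells {} {} \<and> out s' = out s)"
proof -
  define I where "I i s' \<longleftrightarrow> regs s' 1 = i * n" for i and s' :: state
  \<comment> \<open>The base address \<open>n * n\<close> is reached by that many single
    increments.\<close>
  have square: "runs (ntimes 10 (ntimes 11 (Inc 1))) s (n * ((n * (1 + 2) + 2) + 2) + 2) (I n)"
  proof (rule runs_ntimes)
    show "regs s 0 = n" "I 0 (set_reg 10 n s)" using s by (simp_all add: I_def set_reg_def)
    fix i s' assume I: "I i s'" and same: "same (ntimes 10 (ntimes 11 (Inc 1))) s s'"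
    define J where "J j s'' \<longleftrightarrow> regs s'' 1 = i * n + j" for j and s'' :: state
    have "runs (ntimes 11 (Inc 1)) s' (n * (1 + 2) + 2) (J n)"
    proof (rule runs_ntimes)
      show "regs s' 0 = n" using same_regs[OF same] s by simp
    qed (use I in \<open>auto simp: I_def J_def set_reg_def intro!: runs_flat\<close>)
    then show "runs (ntimes 11 (Inc 1)) s' (n * (1 + 2) + 2) (\<lambda>s''. I (Suc i) (set_reg 10 (n - Suc i) s''))"
      by (rule runs_mono) (simp_all add: I_def J_def set_reg_def)
  qed simp
  let ?Q = "\<lambda>s'. ready s' \<and> regs s' 3 = 1"
  have "runs initialise s ((n * ((n * (1 + 2) + 2) + 2) + 2) + (cost (Copy 2 1) + ((n * (1 + 2) + 2) + 3))) ?Q"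
    unfolding initialise_def
  proof (rule runs_Seq[OF square], rule runs_Seq_flat, simp)
    fix s1 assume "I n s1" and same1: "same (ntimes 10 (ntimes 11 (Inc 1))) s s1"
    then have r1: "regs s1 1 = a" "regs s1 0 = n" "regs s1 12 = 0"
      using same_regs[OF same1] s by (simp_all add: I_def a)
    let ?s1 = "sem (Copy 2 1) s1"
    define J where "J j s'' \<longleftrightarrow> regs s'' 2 = a + j" for j and s'' :: state
    have "runs (ntimes 10 (Inc 2)) ?s1 (n * (1 + 2) + 2) (J n)"
      by (rule runs_ntimes) (use r1 in \<open>auto simp: J_def set_reg_def intro!: runs_flat\<close>)
    then show "runs (ntimes 10 (Inc 2) ;; Inc 2 ;; Const 13 1 ;; Const 3 1) ?s1 ((n * (1 + 2) + 2) + 3) ?Q"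
    proof (rule runs_Seq)
      fix s2 assume J: "J n s2" and same2: "same (ntimes 10 (Inc 2)) ?s1 s2"
      have "regs s2 1 = a" "regs s2 0 = n" "regs s2 12 = 0"
        using same_regs[OF same2] r1 by (simp_all add: set_reg_def)
      then show "runs (Inc 2 ;; Const 13 1 ;; Const 3 1) s2 3 ?Q"
        using J unfolding J_def ready_def by (intro runs_flat) (simp_all add: set_reg_def b_eq)
    qed
  qed
  from runs_frame[OF this] show ?thesis
  proof (rule runs_mono)
    fix s' assume "?Q s' \<and> same initialise s s'"
    then show "ready s' \<and> regs s' 3 = 1 \<and> mem s' = cells {} {} \<and> out s' = out s"
      using same_mem[of initialise s s'] same_out[of initialise s s'] s(2)
      by (simp add: initialise_def)
  qed (simp add: algebra_simps)
qed

section \<open>Traversal of all subsets by their binary codes\<close>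

definition outputs_of :: "nat list \<Rightarrow> nat list" where
  "outputs_of ks = concat (map (char_vector n) (filter (\<lambda>A. A \<in> gmdas G) (map set_decode ks)))"

lemma set_encode_lessThan: "set_encode {..<n} = 2 ^ n - 1"
  unfolding set_encode_def by (induction n) auto

lemma set_encode_less: "A \<subseteq> {..<n} \<Longrightarrow> set_encode A < 2 ^ n"
proof -
  assume "A \<subseteq> {..<n}"
  then have "set_encode A \<le> set_encode {..<n}"
    unfolding set_encode_def by (intro sum_mono2) auto
  also have "\<dots> < 2 ^ n" by (simp add: set_encode_lessThan)
  finally show ?thesis .
qed

lemma set_decode_subset:
  assumes "k < 2 ^ n"
  shows "set_decode k \<subseteq> {..<n}"
proof
  fix i assume "i \<in> set_decode k"
  then have "2 ^ i \<le> set_encode (set_decode k)"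
    unfolding set_encode_def by (intro member_le_sum) auto
  then have "2 ^ i \<le> k" by simp
  then have "(2::nat) ^ i < 2 ^ n" using assms by (rule le_less_trans)
  then show "i \<in> {..<n}" by simp
qed

lemma runs_enumerate_step:
  assumes s: "ready s" "regs s 3 = 1" "mem s = cells (set_decode k) B"
    and k: "k < 2 ^ n" and B: "B \<subseteq> {..<n}"
  shows "runs (increment ;; Cond 4 (Const 3 0) process_set) s (n * 8 + 5 + set_time)
    (\<lambda>s'. if Suc k = 2 ^ n then regs s' 3 = 0 \<and> out s' = out s
       else ready s' \<and> regs s' 3 = 1 \<and> (\<exists>B'\<subseteq>{..<n}. mem s' = cells (set_decode (Suc k)) B') \<and>
         out s' = out s @ outputs_of [Suc k])" (is "runs _ _ _ ?Q")
proof -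
  have "set_decode k \<subseteq> {..<n}" by (rule set_decode_subset[OF k])
  from runs_increment[OF s(1,3) this]
  have "runs (increment ;; Cond 4 (Const 3 0) process_set) s ((n * 8 + 4) + (1 + set_time)) ?Q"
  proof (rule runs_Seq)
    fix s1 assume "\<exists>A'\<subseteq>{..<n}. mem s1 = cells A' B \<and>
        (if regs s1 4 = 0 then set_encode A' = Suc (set_encode (set_decode k)) else set_decode k = {..<n})"
      and same: "same increment s s1"
    then obtain A' where A': "A' \<subseteq> {..<n}" "mem s1 = cells A' B"
      "if regs s1 4 = 0 then set_encode A' = Suc k else set_decode k = {..<n}" by auto
    have "ready s1" by (rule same_ready[OF same s(1)]) (simp add: increment_def increment_body_def)
    have 1: "regs s1 3 = 1" "out s1 = out s"
      using same_regs[OF same] same_out[OF same] s(2) by (simp_all add: increment_def increment_body_def)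
    show "runs (Cond 4 (Const 3 0) process_set) s1 (1 + set_time) ?Q"
    proof (rule runs_Cond)
      assume "regs s1 4 \<noteq> 0"
      then have "set_encode (set_decode k) = 2 ^ n - 1" using A'(3) by (simp add: set_encode_lessThan)
      then have "Suc k = 2 ^ n" by simp
      then show "runs (Const 3 0) s1 set_time ?Q"
        using 1 by (intro runs_flat) (simp_all add: set_reg_def set_time_def)
    next
      assume "regs s1 4 = 0"
      then have enc: "set_encode A' = Suc k" using A'(3) by simp
      have "finite A'" using A'(1) finite_subset by blast
      then have dec: "set_decode (Suc k) = A'" using enc by (metis set_encode_inverse)
      have ne: "A' \<noteq> {}" using enc by auto
      have lt: "Suc k < 2 ^ n" using set_encode_less[OF A'(1)] enc by simp
      from runs_frame[OF runs_process_set[OF \<open>ready s1\<close> A'(2,1) B ne]]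
      show "runs process_set s1 set_time ?Q"
      proof (rule runs_mono)
        fix s2 assume *: "(\<exists>B'\<subseteq>{..<n}. mem s2 = cells A' B' \<and>
            out s2 = out s1 @ (if A' \<in> gmdas G then char_vector n A' else [])) \<and> same process_set s1 s2"
        then have same2: "same process_set s1 s2" by simp
        have "ready s2"
          by (rule same_ready[OF same2 \<open>ready s1\<close>]) (simp add: process_set_def writes_try_removal print_set_def)
        moreover have "regs s2 3 = 1"
          using same_regs[OF same2, of 3] 1 by (simp add: process_set_def writes_try_removal print_set_def)
        ultimately show "?Q s2"
          using * lt 1 by (auto simp: outputs_of_def dec)
      qed simp
    qed
  qed
  then show ?thesis by (rule runs_mono) simp_all
qed

text \<open>With code \<open>k\<close> already dealt with, \<open>2 ^ n - k\<close> iterations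
  remain: one for each larger code and one for the overflow that clears the loop flag. The base case
  of the induction is therefore vacuous.\<close>

lemma runs_enumerate:
  assumes "ready s" "regs s 3 = 1" "mem s = cells (set_decode k) B" "k < 2 ^ n" "B \<subseteq> {..<n}"
  shows "runs enumerate_sets s ((2 ^ n - k) * (n * 8 + 6 + set_time) + 1)
    (\<lambda>s'. out s' = out s @ outputs_of [Suc k..<2 ^ n])"
  using assms
proof (induction "2 ^ n - k" arbitrary: s k B)
  case 0
  then show ?case by simp
next
  case (Suc j)
  let ?T = "n * 8 + 5 + set_time"
  have j: "j = 2 ^ n - Suc k" using Suc.hyps(2) by simp
  have "runs enumerate_sets s (1 + ?T + (j * (n * 8 + 6 + set_time) + 1))
    (\<lambda>s'. out s' = out s @ outputs_of [Suc k..<2 ^ n])"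
    unfolding enumerate_sets_def
  proof (rule runs_WhileTrue[OF _ runs_enumerate_step[OF Suc.prems]])
    show "regs s 3 \<noteq> 0" using Suc.prems(2) by simp
    fix s1 assume step: "if Suc k = 2 ^ n then regs s1 3 = 0 \<and> out s1 = out s
       else ready s1 \<and> regs s1 3 = 1 \<and> (\<exists>B'\<subseteq>{..<n}. mem s1 = cells (set_decode (Suc k)) B') \<and>
         out s1 = out s @ outputs_of [Suc k]"
    show "runs (While 3 (increment ;; Cond 4 (Const 3 0) process_set)) s1 (j * (n * 8 + 6 + set_time) + 1)
      (\<lambda>s'. out s' = out s @ outputs_of [Suc k..<2 ^ n])"
    proof (cases "Suc k = 2 ^ n")
      case True
      then have "regs s1 3 = 0" "out s1 = out s" using step by simp_all
      then have "runs (While 3 (increment ;; Cond 4 (Const 3 0) process_set)) s1 1 (\<lambda>s'. s' = s1)"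
        unfolding runs_def using exec_WhileFalse by blast
      then show ?thesis
        by (rule runs_mono) (use True \<open>out s1 = out s\<close> in \<open>simp_all add: outputs_of_def\<close>)
    next
      case False
      then have lt: "Suc k < 2 ^ n" using Suc.prems(4) by simp
      obtain B' where B': "ready s1" "regs s1 3 = 1" "mem s1 = cells (set_decode (Suc k)) B'"
        "B' \<subseteq> {..<n}" "out s1 = out s @ outputs_of [Suc k]" using step False by auto
      have "[Suc k..<2 ^ n] = Suc k # [Suc (Suc k)..<2 ^ n]" using lt by (rule upt_conv_Cons)
      then have "out s @ outputs_of [Suc k..<2 ^ n] = out s1 @ outputs_of [Suc (Suc k)..<2 ^ n]"
        by (simp add: B'(5) outputs_of_def)
      then show ?thesis
        using Suc.hyps(1)[OF j B'(1,2,3) lt B'(4)] by (simp add: enumerate_sets_def flip: j)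
    qed
  qed
  note run = this
  have "1 + ?T + (j * (n * 8 + 6 + set_time) + 1) = (2 ^ n - k) * (n * 8 + 6 + set_time) + 1"
    by (simp flip: Suc.hyps(2))
  with run show ?case by (simp only:)
qed

lemma enumerates_outputs_of:
  assumes "graph_order G = n"
  shows "enumerates_gmdas G (outputs_of [Suc 0..<2 ^ n])"
  unfolding enumerates_gmdas_def
proof (intro exI conjI)
  let ?As = "filter (\<lambda>A. A \<in> gmdas G) (map set_decode [Suc 0..<2 ^ n])"
  show "outputs_of [Suc 0..<2 ^ n] = concat (map (char_vector (graph_order G)) ?As)"
    by (simp add: outputs_of_def assms)
  show "distinct ?As"
    by (intro distinct_filter) (auto simp: distinct_map intro: inj_on_inverseI[of _ set_encode])
  show "set ?As = gmdas G"
  proof (intro equalityI subsetI)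
    fix A assume A: "A \<in> gmdas G"
    then have sub: "A \<subseteq> {..<n}" and ne: "A \<noteq> {}"
      using verts by (auto simp: gmdas_def globally_minimal_defensive_alliance_def defensive_alliance_def)
    have fin: "finite A" using sub finite_subset by blast
    \<comment> \<open>Globally minimal alliances are non-empty, so skipping the code 0 loses
      nothing.\<close>
    have "set_encode A \<noteq> 0"
      using ne fin by (metis set_decode_zero set_encode_inverse)
    then have "set_encode A \<in> set [Suc 0..<2 ^ n]" using set_encode_less[OF sub] by simp
    moreover have "A = set_decode (set_encode A)" using fin by simp
    ultimately show "A \<in> set ?As" using A by auto
  qed auto
qed

lemma runs_gmda_program:
  assumes "graph_order G = n"
  shows "runs gmda_program (input_state G) (n * (n * 3 + 7) + 8 + (2 ^ n * (n * 8 + 6 + set_time) + 1))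
    (\<lambda>s. enumerates_gmdas G (out s))"
  unfolding gmda_program_def
proof (rule runs_Seq)
  have "mem (input_state G) = cells {} {}"
    unfolding input_state_def cells_def assms by (auto simp: a fun_eq_iff)
  then show "runs initialise (input_state G) (n * (n * 3 + 7) + 8)
    (\<lambda>s'. ready s' \<and> regs s' 3 = 1 \<and> mem s' = cells {} {} \<and> out s' = out (input_state G))"
    by (intro runs_initialise) (simp_all add: input_state_def assms)
  fix s assume s: "ready s \<and> regs s 3 = 1 \<and> mem s = cells {} {} \<and> out s = out (input_state G)"
  then have "runs enumerate_sets s ((2 ^ n - 0) * (n * 8 + 6 + set_time) + 1)
    (\<lambda>s'. out s' = out s @ outputs_of [Suc 0..<2 ^ n])"
    by (intro runs_enumerate[where B = "{}"]) simp_all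
  then show "runs enumerate_sets s (2 ^ n * (n * 8 + 6 + set_time) + 1) (\<lambda>s. enumerates_gmdas G (out s))"
    using enumerates_outputs_of[OF assms] s by (elim runs_mono) (simp_all add: input_state_def)
qed

end

lemma gmda_program_correct:
  assumes "pair_graph G" "pverts G = {..<graph_order G}"
  defines "n \<equiv> graph_order G"
  shows "\<exists>t s. exec gmda_program (input_state G) t s \<and> enumerates_gmdas G (out s) \<and>
    t \<le> (n * (n * 3 + 7) + n * 8 + 15 + (Suc n * (n * (n * (n * 12 + 13) + 22) + 16) + n * 5 + 10)) * 2 ^ n"
proof -
  interpret layout G n "n * n" "n * n + n + 1"
    by (rule layout.intro[OF assms(1) assms(2)[folded n_def] refl refl])
  let ?m = "n * (n * 3 + 7) + 8"
  \<comment> \<open>The additive cost of the initialisation is charged to the factor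
    \<open>2 ^ n\<close>, which is at least 1.\<close>
  have "?m + (2 ^ n * (n * 8 + 6 + set_time) + 1) \<le> (?m + 1) * 2 ^ n + 2 ^ n * (n * 8 + 6 + set_time)"
  proof -
    have "(?m + 1) * 1 \<le> (?m + 1) * 2 ^ n" by (intro mult_left_mono) auto
    then show ?thesis by simp
  qed
  also have "\<dots> = (n * (n * 3 + 7) + n * 8 + 15 + (Suc n * (n * (n * (n * 12 + 13) + 22) + 16) + n * 5 + 10)) * 2 ^ n"
    by (simp add: set_time_def algebra_simps)
  finally have "runs gmda_program (input_state G) ((n * (n * 3 + 7) + n * 8 + 15 +
      (Suc n * (n * (n * (n * 12 + 13) + 22) + 16) + n * 5 + 10)) * 2 ^ n)
    (\<lambda>s. enumerates_gmdas G (out s))"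
    by (rule runs_mono[OF runs_gmda_program[OF n_def[symmetric, THEN meta_eq_to_obj_eq]]])
  then show ?thesis unfolding runs_def by blast
qed

lemma gmdas_enumerable:
  "\<exists>c. \<exists>p :: real poly. \<forall>G :: nat pair_pre_digraph.
    pair_graph G \<and> pverts G = {..<graph_order G} \<longrightarrow>
    (\<exists>t s. exec c (input_state G) t s \<and> enumerates_gmdas G (out s) \<and>
       real t \<le> poly p (real (graph_order G)) * 2 ^ graph_order G)"
proof -
  define x :: "real poly" where "x = [:0, 1:]"
  \<comment> \<open>The polynomial copies the shape of the time bound with \<open>x\<close> in place
    of \<open>n\<close>, so that its value at \<open>n\<close> simplifies to that bound.\<close>
  define p where "p = x * (x * [:3:] + [:7:]) + x * [:8:] + [:15:] +
    ((x + 1) * (x * (x * (x * [:12:] + [:13:]) + [:22:]) + [:16:]) + x * [:5:] + [:10:])"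
  have "\<exists>t s. exec gmda_program (input_state G) t s \<and> enumerates_gmdas G (out s) \<and>
      real t \<le> poly p (real (graph_order G)) * 2 ^ graph_order G"
    if G: "pair_graph G" "pverts G = {..<graph_order G}" for G :: "nat pair_pre_digraph"
  proof -
    define n where "n = graph_order G"
    obtain t s where ts: "exec gmda_program (input_state G) t s" "enumerates_gmdas G (out s)"
      "t \<le> (n * (n * 3 + 7) + n * 8 + 15 +
        (Suc n * (n * (n * (n * 12 + 13) + 22) + 16) + n * 5 + 10)) * 2 ^ n"
      using gmda_program_correct[OF G] unfolding n_def by blast
    have "real t \<le> real ((n * (n * 3 + 7) + n * 8 + 15 +
        (Suc n * (n * (n * (n * 12 + 13) + 22) + 16) + n * 5 + 10)) * 2 ^ n)"
      using ts(3) by (rule of_nat_mono)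
    also have "\<dots> = poly p (real n) * 2 ^ n" by (simp add: p_def x_def algebra_simps)
    finally show ?thesis using ts(1,2) unfolding n_def by blast
  qed
  then show ?thesis by blast
qed

section \<open>Subtrees of trees\<close>

text \<open>Connectivity as plain reachability along arcs that stay in \<open>S\<close>; unlike
  \<open>connected\<close>, it also holds for the empty set.\<close>

definition linked :: "'a rel \<Rightarrow> 'a set \<Rightarrow> bool" where
  "linked R S \<longleftrightarrow> (\<forall>u\<in>S. \<forall>v\<in>S. (u, v) \<in> (R \<inter> S \<times> S)\<^sup>*)"

lemma linkedI_via:
  assumes "sym R" and "c \<in> S" and "\<And>u. u \<in> S \<Longrightarrow> (u, c) \<in> (R \<inter> S \<times> S)\<^sup>*"
  shows "linked R S"
proof -
  have "sym ((R \<inter> S \<times> S)\<^sup>*)"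
    using assms(1) by (intro sym_rtrancl) (auto simp: sym_def)
  then have "(c, v) \<in> (R \<inter> S \<times> S)\<^sup>*" if "v \<in> S" for v
    using assms(3)[OF that] by (auto dest: symD)
  then show ?thesis
    unfolding linked_def using assms(3) by (meson rtrancl_trans)
qed

lemma linked_Un:
  assumes "sym R" and "linked R S" and "linked R S'" and "S \<inter> S' \<noteq> {}"
  shows "linked R (S \<union> S')"
proof -
  obtain c where c: "c \<in> S" "c \<in> S'" using assms(4) by blast
  show ?thesis
  proof (rule linkedI_via[OF assms(1)])
    show "c \<in> S \<union> S'" using c by simp
    have "(R \<inter> S \<times> S)\<^sup>* \<subseteq> (R \<inter> (S \<union> S') \<times> (S \<union> S'))\<^sup>*"
      "(R \<inter> S' \<times> S')\<^sup>* \<subseteq> (R \<inter> (S \<union> S') \<times> (S \<union> S'))\<^sup>*"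
      by (auto intro!: rtrancl_mono)
    then show "(u, c) \<in> (R \<inter> (S \<union> S') \<times> (S \<union> S'))\<^sup>*" if "u \<in> S \<union> S'" for u
      using assms(2,3) c that unfolding linked_def by blast
  qed
qed

text \<open>The arcs of a \<open>pair_graph\<close> are symmetric already, so the symmetrisation
  inside \<open>connected\<close> adds none.\<close>

lemma connected_induced_iff_linked:
  assumes "pair_graph T" and "S \<subseteq> pverts T"
  shows "Digraph_Component.connected (with_proj T \<restriction> S) \<longleftrightarrow> S \<noteq> {} \<and> linked (parcs T) S"
proof -
  interpret pair_graph T by fact
  have eq: "parcs (mk_symmetric (with_proj T \<restriction> S)) = parcs T \<inter> S \<times> S"
    using arcs_symmetric by (auto simp: parcs_mk_symmetric induce_subgraph_def)
  have "((u, v) \<in> rtrancl_on S (parcs T \<inter> S \<times> S)) = ((u, v) \<in> (parcs T \<inter> S \<times> S)\<^sup>*)"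
    if "u \<in> S" "v \<in> S" for u v
    using that by (auto intro: rtrancl_on_rtranclI rtrancl_consistent_rtrancl_on)
  then show ?thesis
    using assms(2)
    unfolding Digraph_Component.connected_def strongly_connected_def reachable_def linked_def
    by (auto simp: eq)
qed

text \<open>A path from \<open>b\<close> to \<open>a\<close> that avoids the edge would close with
  it to a cycle. Since the edge is removed in both directions, the path has at least two arcs, and
  the cycle reaches the length 3 that \<open>undirected_tree\<close> forbids.\<close>

lemma tree_arc_is_bridge:
  assumes "undirected_tree T" and "(a, b) \<in> parcs T"
  shows "(b, a) \<notin> (parcs T - {(a, b), (b, a)})\<^sup>*"
proof
  assume reach: "(b, a) \<in> (parcs T - {(a, b), (b, a)})\<^sup>*"
  interpret T: pair_graph T using assms(1) by (simp add: undirected_tree_def)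
  define U where "U = \<lparr>pverts = pverts T, parcs = parcs T - {(a, b), (b, a)}\<rparr>"
  interpret U: pair_wf_digraph U
    by unfold_locales (auto simp: U_def dest: T.in_arcsD1 T.in_arcsD2)
  have ab: "a \<noteq> b" "a \<in> pverts T" "b \<in> pverts T"
    using assms(2) T.no_loops' T.in_arcsD1 T.in_arcsD2 by blast+
  have "reachable (with_proj U) b a"
    using reach ab by (subst U.reachable_conv') (auto simp: U_def)
  then obtain p where "U.apath b p a" using U.reachable_apath by blast
  then have w: "U.awalk b p a" and d: "distinct (pawalk_verts b p)"
    by (auto simp: U.apath_def)
  have sub: "set p \<subseteq> parcs U" and cas: "pcas b p a"
    using w by (auto simp: U.awalk_def)
  have "T.awalk a ((a, b) # p) a"
    using sub cas ab assms(2) by (auto simp: T.awalk_def U_def)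
  then have "T.cycle ((a, b) # p)"
    using d by (auto simp: T.cycle_def)
  moreover have "length p \<ge> 2"
  proof -
    have "p \<noteq> []" using cas ab by auto
    moreover have "p \<noteq> [e]" for e using cas sub by (auto simp: U_def)
    ultimately show ?thesis by (cases p; cases "tl p") auto
  qed
  ultimately show False
    using assms(1) unfolding undirected_tree_def
    by (metis One_nat_def Suc_1 Suc_le_mono length_Cons numeral_3_eq_3)
qed

text \<open>Induction from the start of the walk: either the tail already contains the last exit
  from \<open>A\<close>, or it avoids \<open>A\<close>, and then a start in \<open>A\<close> makes
  the first arc that exit.\<close>

lemma rtrancl_last_exit:
  assumes "(p, q) \<in> (R \<inter> B \<times> B)\<^sup>*" and "q \<notin> A"
  shows "(p, q) \<in> (R \<inter> (B - A) \<times> (B - A))\<^sup>* \<or>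
    (\<exists>a b. (a, b) \<in> R \<and> a \<in> A \<inter> B \<and> b \<in> B - A \<and> (b, q) \<in> (R \<inter> (B - A) \<times> (B - A))\<^sup>*)"
  using assms(1)
proof (induction rule: converse_rtrancl_induct)
  case (step x y)
  have "y \<notin> A" if "(y, q) \<in> (R \<inter> (B - A) \<times> (B - A))\<^sup>*"
    using that assms(2) by (auto elim: converse_rtranclE)
  with step show ?case
    by (cases "x \<in> A") (auto intro: converse_rtrancl_into_rtrancl)
qed simp

text \<open>Suppose there is no common point, and walk inside \<open>B\<close> from \<open>A\<close>
  to \<open>C\<close>; let the edge from \<open>a\<close> to \<open>b\<close> be the last exit from
  \<open>A\<close>. One can return from \<open>b\<close> to \<open>a\<close> through
  \<open>B - A\<close>, then \<open>C\<close>, then \<open>A\<close>. None of the three parts uses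
  that edge, because \<open>a\<close> lies neither in \<open>B - A\<close> nor in \<open>C\<close>,
  and \<open>b\<close> is not in \<open>A\<close>. This contradicts that the edge is a
  bridge.\<close>

lemma tree_subtrees_Helly:
  assumes T: "undirected_tree T"
    and lnk: "linked (parcs T) A" "linked (parcs T) B" "linked (parcs T) C"
    and "A \<inter> B \<noteq> {}" "B \<inter> C \<noteq> {}" "A \<inter> C \<noteq> {}"
  shows "A \<inter> B \<inter> C \<noteq> {}"
proof
  assume none: "A \<inter> B \<inter> C = {}"
  obtain p q r where pqr: "p \<in> A" "p \<in> B" "q \<in> B" "q \<in> C" "r \<in> A" "r \<in> C"
    using assms(5-7) by blast
  let ?R = "parcs T"
  have "(p, q) \<in> (?R \<inter> B \<times> B)\<^sup>*" using lnk(2) pqr by (auto simp: linked_def)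
  moreover have "q \<notin> A" using none pqr by blast
  moreover have "(p, q) \<notin> (?R \<inter> (B - A) \<times> (B - A))\<^sup>*"
    using pqr \<open>q \<notin> A\<close> by (auto elim: converse_rtranclE)
  ultimately obtain a b where ab: "(a, b) \<in> ?R" "a \<in> A" "a \<in> B" "b \<notin> A"
    and bq: "(b, q) \<in> (?R \<inter> (B - A) \<times> (B - A))\<^sup>*"
    using rtrancl_last_exit[of p q ?R B A] by blast
  define E where "E = ?R - {(a, b), (b, a)}"
  interpret T: pair_graph T using T by (simp add: undirected_tree_def)
  have symE: "sym (E\<^sup>*)"
    by (intro sym_rtrancl) (auto simp: E_def sym_def intro: T.arcs_symmetric)
  have "a \<notin> C" using none ab by blast
  have "(?R \<inter> A \<times> A)\<^sup>* \<subseteq> E\<^sup>*" "(?R \<inter> C \<times> C)\<^sup>* \<subseteq> E\<^sup>*" "(?R \<inter> (B - A) \<times> (B - A))\<^sup>* \<subseteq> E\<^sup>*"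
    using ab \<open>a \<notin> C\<close> by (auto simp: E_def intro!: rtrancl_mono)
  moreover have "(r, a) \<in> (?R \<inter> A \<times> A)\<^sup>*" "(q, r) \<in> (?R \<inter> C \<times> C)\<^sup>*"
    using lnk ab pqr by (auto simp: linked_def)
  ultimately have "(b, a) \<in> E\<^sup>*"
    using bq by (meson rtrancl_trans subsetD)
  then show False
    using tree_arc_is_bridge[OF T ab(1)] by (simp add: E_def)
qed

text \<open>Arcs of a walk alternately leave and enter the centre \<open>c\<close>, so a closed walk
  with at least three arcs enters \<open>c\<close> twice, while the heads of the arcs of a cycle are
  distinct.\<close>

lemma star_no_long_cycle:
  assumes arcs: "\<And>u v. (u, v) \<in> parcs T \<Longrightarrow> u = c \<and> v \<noteq> c \<or> u \<noteq> c \<and> v = c"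
    and cyc: "pre_digraph.cycle (with_proj T) p"
  shows "length p < 3"
proof (rule ccontr)
  assume "\<not> length p < 3"
  then obtain e1 e2 e3 q where p: "p = e1 # e2 # e3 # q"
    by (metis Suc_le_length_iff not_less numeral_3_eq_3)
  interpret pair_pre_digraph T .
  obtain u where u: "set p \<subseteq> parcs T" "pcas u p u" "distinct (tl (pawalk_verts u p))"
    using cyc by (auto simp: cycle_def awalk_def)
  have q: "pawalk_verts v q = v # map snd q" if "pcas v q w" for v w
    using that by (induction q arbitrary: v) auto
  have e: "e1 \<in> parcs T" "e2 \<in> parcs T" "e3 \<in> parcs T"
    "fst e1 = u" "fst e2 = snd e1" "fst e3 = snd e2" "pcas (snd e3) q u"
    using u by (auto simp: p)
  have d: "distinct (snd e1 # snd e2 # snd e3 # map snd q)"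
    using u(3) by (simp add: p q[OF e(7)] e(5,6))
  have last: "(q = [] \<and> v = w) \<or> w \<in> snd ` set q" if "pcas v q w" for v w
    using that by (induction q arbitrary: v) fastforce+
  have "fst e = c \<and> snd e \<noteq> c \<or> fst e \<noteq> c \<and> snd e = c" if "e \<in> parcs T" for e
    using arcs[of "fst e" "snd e"] that by simp
  from this[OF e(1)] this[OF e(2)] this[OF e(3)] show False
    using last[OF e(7)] d e(4-6) by (auto simp: image_iff)
qed

section \<open>Parameters of complete bipartite graphs\<close>

definition biclique :: "'a set \<Rightarrow> 'a set \<Rightarrow> 'a pair_pre_digraph" where
  "biclique X Y = \<lparr>pverts = X \<union> Y, parcs = X \<times> Y \<union> Y \<times> X\<rparr>"

lemma biclique_simps [simp]:
  "pverts (biclique X Y) = X \<union> Y"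
  "parcs (biclique X Y) = X \<times> Y \<union> Y \<times> X"
  by (simp_all add: biclique_def)

lemma pair_graph_biclique:
  assumes "finite X" "finite Y" "X \<inter> Y = {}"
  shows "pair_graph (biclique X Y)"
  using assms by unfold_locales (auto simp: symmetric_def sym_def)

lemma complete_bipartite_biclique:
  assumes "finite X" "finite Y" "X \<inter> Y = {}" "X \<noteq> {}" "Y \<noteq> {}"
  shows "complete_bipartite (biclique X Y)"
  unfolding complete_bipartite_def complete_bipartite_digraph_pair_def
  using assms by (intro exI[of _ "card X"] exI[of _ "card Y"]) (auto simp: card_gt_0_iff)

lemma nbhd_biclique:
  assumes "X \<inter> Y = {}"
  shows "v \<in> X \<Longrightarrow> nbhd (biclique X Y) v = Y" "v \<in> Y \<Longrightarrow> nbhd (biclique X Y) v = X"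
  using assms by (auto simp: nbhd_def)

text \<open>The second vertex of \<open>X\<close> separates the two classes: \<open>X - {u}\<close>
  is non-empty and disjoint from \<open>Y\<close>. In a single edge, the two ends would be
  equivalent.\<close>

lemma neighborhood_diversity_biclique:
  assumes disj: "X \<inter> Y = {}" and "2 \<le> card X" and "Y \<noteq> {}"
  shows "neighborhood_diversity (biclique X Y) = 2"
proof -
  let ?G = "biclique X Y"
  let ?R = "{(u, v). u \<in> pverts ?G \<and> v \<in> pverts ?G \<and> nbhd ?G v - {u} = nbhd ?G u - {v}}"
  have X: "X - {x} \<noteq> {}" for x
  proof
    assume "X - {x} = {}"
    then have "card X \<le> card {x}" by (intro card_mono) auto
    then show False using assms(2) by simp
  qed
  have "X \<noteq> {}" using X by blast
  have R: "?R = X \<times> X \<union> Y \<times> Y"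
  proof (intro equalityI subsetI)
    fix e assume e: "e \<in> ?R"
    obtain u v where uv: "e = (u, v)" by fastforce
    have "\<not> (u \<in> X \<and> v \<in> Y)" "\<not> (u \<in> Y \<and> v \<in> X)"
    proof -
      have e': "nbhd ?G v - {u} = nbhd ?G u - {v}" using e by (simp add: uv)
      show "\<not> (u \<in> X \<and> v \<in> Y)"
        using e' X[of u] disj nbhd_biclique[OF disj] by (metis Diff_subset disjoint_iff subset_empty subset_iff)
      show "\<not> (u \<in> Y \<and> v \<in> X)"
        using e' X[of v] disj nbhd_biclique[OF disj] by (metis Diff_subset disjoint_iff subset_empty subset_iff)
    qed
    then show "e \<in> X \<times> X \<union> Y \<times> Y" using e by (auto simp: uv)
  next
    fix e assume "e \<in> X \<times> X \<union> Y \<times> Y"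
    then show "e \<in> ?R" using disj by (auto simp: nbhd_biclique)
  qed
  have "pverts ?G // ?R = {X, Y}"
    using disj \<open>X \<noteq> {}\<close> \<open>Y \<noteq> {}\<close> unfolding R quotient_def by auto
  moreover have "X \<noteq> Y" using disj \<open>X \<noteq> {}\<close> by blast
  ultimately show ?thesis by (simp add: neighborhood_diversity_def)
qed

lemma vertex_cover_biclique:
  "vertex_cover (biclique X Y) Z \<longleftrightarrow> Z \<subseteq> X \<union> Y \<and> (X \<subseteq> Z \<or> Y \<subseteq> Z)"
  by (auto simp: vertex_cover_def)

text \<open>With two vertices in \<open>X\<close>, the ends of an edge never have equal closed
  neighbourhoods, so the third alternative of a twin cover is void.\<close>

lemma twin_cover_biclique:
  assumes "X \<inter> Y = {}" and "2 \<le> card X"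
  shows "twin_cover (biclique X Y) = vertex_cover (biclique X Y)"
proof -
  have "closed_nbhd (biclique X Y) u \<noteq> closed_nbhd (biclique X Y) v" if "u \<in> X" "v \<in> Y" for u v
  proof
    assume "closed_nbhd (biclique X Y) u = closed_nbhd (biclique X Y) v"
    then have "insert u Y = insert v X"
      using assms(1) that by (simp add: closed_nbhd_def nbhd_biclique)
    then have "X \<subseteq> {u}" using assms(1) by blast
    then have "card X \<le> card {u}" by (intro card_mono) auto
    then show False using assms(2) by simp
  qed
  then show ?thesis
    by (fastforce simp: twin_cover_def vertex_cover_def fun_eq_iff)
qed

lemma
  assumes "finite X" "finite Y" "X \<inter> Y = {}" "card X \<le> card Y"
  shows vertex_cover_number_biclique: "vertex_cover_number (biclique X Y) = card X"
    and twin_cover_number_biclique: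
      "2 \<le> card X \<Longrightarrow> twin_cover_number (biclique X Y) = card X"
proof -
  show *: "vertex_cover_number (biclique X Y) = card X"
    unfolding vertex_cover_number_def
  proof (rule Least_equality)
    show "\<exists>Z. vertex_cover (biclique X Y) Z \<and> card Z = card X"
      by (intro exI[of _ X]) (simp add: vertex_cover_biclique)
    fix k assume "\<exists>Z. vertex_cover (biclique X Y) Z \<and> card Z = k"
    then obtain Z where Z: "Z \<subseteq> X \<union> Y" "X \<subseteq> Z \<or> Y \<subseteq> Z" "card Z = k"
      by (auto simp: vertex_cover_biclique)
    then have "finite Z" using assms finite_subset by blast
    then have "card X \<le> card Z \<or> card Y \<le> card Z" using Z card_mono by blast
    then show "card X \<le> k" using Z assms(4) by auto
  qed
  show "twin_cover_number (biclique X Y) = card X" if "2 \<le> card X"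
    using * twin_cover_biclique[OF assms(3) that]
    by (simp add: twin_cover_number_def vertex_cover_number_def)
qed

section \<open>Cographs and cliquewidth\<close>

lemma cograph_edgeless: "finite S \<Longrightarrow> S \<noteq> {} \<Longrightarrow> cograph \<lparr>pverts = S, parcs = {}\<rparr>"
proof (induction S rule: finite_ne_induct)
  case (singleton v)
  show ?case by (rule cograph_vertex)
next
  case (insert v S)
  then show ?case using cograph_union[OF cograph_vertex[of v] insert.IH] by simp
qed

text \<open>A biclique is the complement of two disjoint cliques, and each clique is the complement
  of an edgeless graph.\<close>

lemma cograph_biclique:
  assumes "finite X" "finite Y" "X \<inter> Y = {}" "X \<noteq> {}" "Y \<noteq> {}"
  shows "cograph (biclique X Y)"
proof -
  let ?K = "\<lambda>S. graph_complement \<lparr>pverts = S, parcs = {}\<rparr>"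
  have "cograph (?K X)" "cograph (?K Y)"
    using assms by (simp_all add: cograph_complement cograph_edgeless)
  moreover have "pverts (?K X) \<inter> pverts (?K Y) = {}"
    using assms(3) by (simp add: graph_complement_def)
  ultimately have "cograph (graph_complement \<lparr>pverts = pverts (?K X) \<union> pverts (?K Y),
      parcs = parcs (?K X) \<union> parcs (?K Y)\<rparr>)"
    by (intro cograph_complement[OF cograph_union])
  also have "graph_complement \<lparr>pverts = pverts (?K X) \<union> pverts (?K Y),
      parcs = parcs (?K X) \<union> parcs (?K Y)\<rparr> = biclique X Y"
    using assms(3) by (auto simp: graph_complement_def biclique_def)
  finally show ?thesis .
qed

lemma cw_constructible_edgeless:
  assumes "finite S" "S \<noteq> {}" "i < k"
  shows "\<exists>lab. cw_constructible k \<lparr>pverts = S, parcs = {}\<rparr> lab \<and> (\<forall>v\<in>S. lab v = i)"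
  using assms
proof (induction S rule: finite_ne_induct)
  case (singleton v)
  then show ?case using cw_vertex by fastforce
next
  case (insert v S)
  then obtain lab where "cw_constructible k \<lparr>pverts = S, parcs = {}\<rparr> lab" "\<forall>v\<in>S. lab v = i"
    by blast
  with cw_union[OF cw_vertex[OF \<open>i < k\<close>, of v] this(1)] insert.hyps show ?case
    by (intro exI[of _ "\<lambda>u. if u \<in> {v} then i else lab u"]) auto
qed

lemma cw_constructible_biclique:
  assumes "finite X" "finite Y" "X \<inter> Y = {}" "X \<noteq> {}" "Y \<noteq> {}"
  shows "\<exists>lab. cw_constructible 2 (biclique X Y) lab"
proof -
  obtain f where f: "cw_constructible 2 \<lparr>pverts = X, parcs = {}\<rparr> f" "\<forall>v\<in>X. f v = 0"
    using cw_constructible_edgeless[OF assms(1,4), of 0 2] by auto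
  obtain g where g: "cw_constructible 2 \<lparr>pverts = Y, parcs = {}\<rparr> g" "\<forall>v\<in>Y. g v = 1"
    using cw_constructible_edgeless[OF assms(2,5), of 1 2] by auto
  let ?lab = "\<lambda>v. if v \<in> X then f v else g v"
  have "cw_constructible 2 \<lparr>pverts = X \<union> Y, parcs = {}\<rparr> ?lab"
    using cw_union[OF f(1) g(1)] assms(3) by simp
  from cw_join[OF this, of 0 1]
  have "cw_constructible 2 \<lparr>pverts = X \<union> Y, parcs = {(u, v). u \<in> X \<union> Y \<and> v \<in> X \<union> Y \<and>
      {?lab u, ?lab v} = {0, 1}}\<rparr> ?lab" by simp
  also have "{(u, v). u \<in> X \<union> Y \<and> v \<in> X \<union> Y \<and> {?lab u, ?lab v} = {0, 1}} = X \<times> Y \<union> Y \<times> X"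
    using f(2) g(2) assms(3) by (auto simp: doubleton_eq_iff split: if_splits)
  finally show ?thesis by (auto simp: biclique_def)
qed

text \<open>A join needs two different labels, so with at most one label no arc is ever
  created.\<close>

lemma cw_constructible_one_edgeless:
  "cw_constructible k G lab \<Longrightarrow> k \<le> 1 \<Longrightarrow> parcs G = {}"
  by (induction rule: cw_constructible.induct) auto

lemma cliquewidth_biclique:
  assumes "finite X" "finite Y" "X \<inter> Y = {}" "X \<noteq> {}" "Y \<noteq> {}"
  shows "cliquewidth (biclique X Y) = 2"
  unfolding cliquewidth_def
proof (rule Least_equality)
  show "\<exists>lab. cw_constructible 2 (biclique X Y) lab"
    by (rule cw_constructible_biclique[OF assms])
  fix k assume "\<exists>lab. cw_constructible k (biclique X Y) lab"
  then show "2 \<le> k"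
    using cw_constructible_one_edgeless[of k "biclique X Y"] assms(4,5) by force
qed

lemma treewidth_biclique:
  fixes X Y :: "nat set"
  assumes "finite Y" "X \<inter> Y = {}" "card X = 2" "2 \<le> card Y"
  shows "treewidth (biclique X Y) = 2"
  unfolding treewidth_def
proof (rule Least_equality)
  have fin: "finite X" using assms(3) by (metis card.infinite zero_neq_numeral)
  obtain c where c: "c \<in> Y" using assms(4) by fastforce
  \<comment> \<open>The nodes of the tree are the vertices of \<open>Y\<close> themselves, hence the
    restriction to \<open>nat\<close>. Any tree on \<open>Y\<close> with the bags
    \<open>insert t X\<close> would do; in a star, the absence of cycles is easy to check.\<close>
  define T where "T = biclique {c} (Y - {c})"
  have T: "pverts T = Y" "parcs T = {c} \<times> (Y - {c}) \<union> (Y - {c}) \<times> {c}"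
    using c by (auto simp: T_def)
  have pT: "pair_graph T"
    unfolding T_def by (rule pair_graph_biclique) (use assms in auto)
  then interpret T: pair_graph T .
  have lT: "linked (parcs T) Y"
  proof (rule linkedI_via[OF _ c])
    show "sym (parcs T)" by (auto simp: T sym_def)
    show "(u, c) \<in> (parcs T \<inter> Y \<times> Y)\<^sup>*" if "u \<in> Y" for u
      using that c by (cases "u = c") (auto simp: T)
  qed
  have "Digraph_Component.connected (with_proj T \<restriction> pverts T)"
    using lT c by (subst connected_induced_iff_linked[OF pT]) (auto simp: T)
  also have "with_proj T \<restriction> pverts T = with_proj T"
    using c by (auto simp: induce_subgraph_def with_proj_def T)
  finally have tree: "undirected_tree T"
    using pT star_no_long_cycle[of T c] by (force simp: undirected_tree_def T)
  have "tree_decomposition (biclique X Y) T (\<lambda>t. insert t X)"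
    unfolding tree_decomposition_def
  proof (intro conjI tree ballI)
    show "(\<Union>t\<in>pverts T. insert t X) = pverts (biclique X Y)" using c by (auto simp: T)
    fix e assume "e \<in> parcs (biclique X Y)"
    then show "case e of (u, v) \<Rightarrow> \<exists>t\<in>pverts T. u \<in> insert t X \<and> v \<in> insert t X"
      by (auto simp: T)
  next
    fix v assume "v \<in> pverts (biclique X Y)"
    then consider "v \<in> X" | "v \<in> Y" "v \<notin> X" using assms(2) by auto
    then have "{t \<in> pverts T. v \<in> insert t X} = Y \<or> {t \<in> pverts T. v \<in> insert t X} = {v}"
      by cases (auto simp: T)
    then show "Digraph_Component.connected (with_proj T \<restriction> {t \<in> pverts T. v \<in> insert t X})"
      using lT c by (subst connected_induced_iff_linked[OF pT]) (auto simp: linked_def)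
  qed
  moreover have "card (insert t X) \<le> 2 + 1" for t
    using fin assms(3) by (simp add: card_insert_if)
  ultimately show "\<exists>T bag. tree_decomposition (biclique X Y) T bag \<and>
      (\<forall>t\<in>pverts T. card (bag t) \<le> 2 + 1)"
    by blast
next
  fix k assume "\<exists>T bag. tree_decomposition (biclique X Y) T bag \<and> (\<forall>t\<in>pverts T. card (bag t) \<le> k + 1)"
  then obtain T bag where td: "tree_decomposition (biclique X Y) T bag"
    and k: "\<And>t. t \<in> pverts T \<Longrightarrow> card (bag t) \<le> k + 1" by blast
  have fin: "finite X" using assms(3) by (metis card.infinite zero_neq_numeral)
  obtain x1 x2 where x: "x1 \<in> X" "x2 \<in> X" "x1 \<noteq> x2" using assms(3) by (auto simp: card_2_iff)
  obtain y1 y2 where y: "y1 \<in> Y" "y2 \<in> Y" "y1 \<noteq> y2"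
    using assms(4) by (auto simp: card_le_Suc0_iff_eq[OF assms(1)] not_less_eq_eq[symmetric] numeral_2_eq_2)
  define S where "S v = {t \<in> pverts T. v \<in> bag t}" for v
  have tree: "undirected_tree T" using td by (simp add: tree_decomposition_def)
  interpret T: pair_graph T using tree by (simp add: undirected_tree_def)
  have sym: "sym (parcs T)" using T.arcs_symmetric by (auto simp: sym_def)
  have lS: "linked (parcs T) (S v)" if "v \<in> X \<union> Y" for v
  proof -
    have "Digraph_Component.connected (with_proj T \<restriction> S v)"
      using td that by (simp add: tree_decomposition_def S_def)
    then show ?thesis
      using connected_induced_iff_linked[OF T.pair_graph, of "S v"] by (simp add: S_def)
  qed
  have meet: "S u \<inter> S v \<noteq> {}" if "u \<in> X" "v \<in> Y" for u v
  proof -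
    have "(u, v) \<in> parcs (biclique X Y)" using that by simp
    then obtain t where "t \<in> pverts T" "u \<in> bag t" "v \<in> bag t"
      using td unfolding tree_decomposition_def by blast
    then show ?thesis by (auto simp: S_def)
  qed
  txt \<open>Contracting the arc from \<open>x2\<close> to \<open>y2\<close> turns the cycle \<open>x1, y1, x2, y2\<close> into a triangle.\<close>
  have "S x1 \<inter> S y1 \<inter> (S x2 \<union> S y2) \<noteq> {}"
  proof (rule tree_subtrees_Helly[OF tree])
    show "linked (parcs T) (S x2 \<union> S y2)"
      by (rule linked_Un[OF sym]) (use lS meet x y in auto)
    show "S y1 \<inter> (S x2 \<union> S y2) \<noteq> {}" using meet[OF x(2) y(1)] by blast
    show "S x1 \<inter> (S x2 \<union> S y2) \<noteq> {}" using meet[OF x(1) y(2)] by blast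
  qed (use lS meet x y in auto)
  then obtain t where t: "t \<in> pverts T" "x1 \<in> bag t" "y1 \<in> bag t" "x2 \<in> bag t \<or> y2 \<in> bag t"
    by (auto simp: S_def)
  then obtain z where z: "{x1, y1, z} \<subseteq> bag t" "z \<noteq> x1" "z \<noteq> y1" "x1 \<noteq> y1"
    using x y assms(2) by auto
  have "finite (bag t)"
    using td t(1) fin assms(1) by (auto simp: tree_decomposition_def intro: finite_subset)
  then have "card {x1, y1, z} \<le> card (bag t)" using z(1) by (rule card_mono)
  then show "2 \<le> k" using k[OF t(1)] z by simp
qed

lemma pathwidth_biclique:
  assumes "finite Y" "X \<inter> Y = {}" "card X = 2" "2 \<le> card Y"
  shows "pathwidth (biclique X Y) = 2"
  unfolding pathwidth_def
proof (rule Least_equality)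
  have fin: "finite X" using assms(3) by (metis card.infinite zero_neq_numeral)
  obtain ys where ys: "set ys = Y" "distinct ys" using assms(1) finite_distinct_list by blast
  obtain c where c: "c \<in> Y" using assms(4) by fastforce
  have "path_decomposition (biclique X Y) (map (\<lambda>y. insert y X) ys)"
    unfolding path_decomposition_def
  proof (intro conjI allI impI)
    show "\<Union> (set (map (\<lambda>y. insert y X) ys)) = pverts (biclique X Y)" using c ys by auto
    show "\<forall>(u, v)\<in>parcs (biclique X Y). \<exists>Z\<in>set (map (\<lambda>y. insert y X) ys). u \<in> Z \<and> v \<in> Z"
      using ys by auto
    fix i j k assume ijk: "i \<le> j \<and> j \<le> k \<and> k < length (map (\<lambda>y. insert y X) ys)"
    have "ys ! i \<noteq> ys ! k" if "i \<noteq> k" using ijk ys(2) that by (simp add: nth_eq_iff_index_eq)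
    then show "map (\<lambda>y. insert y X) ys ! i \<inter> map (\<lambda>y. insert y X) ys ! k
        \<subseteq> map (\<lambda>y. insert y X) ys ! j"
      using ijk by (cases "i = k") auto
  qed
  moreover have "card (insert t X) \<le> 2 + 1" for t
    using fin assms(3) by (simp add: card_insert_if)
  ultimately show "\<exists>bags. path_decomposition (biclique X Y) bags \<and> (\<forall>Z\<in>set bags. card Z \<le> 2 + 1)"
    by (intro exI[of _ "map (\<lambda>y. insert y X) ys"]) auto
next
  fix k assume "\<exists>bags. path_decomposition (biclique X Y) bags \<and> (\<forall>Z\<in>set bags. card Z \<le> k + 1)"
  then obtain bags where pd: "path_decomposition (biclique X Y) bags"
    and k: "\<And>Z. Z \<in> set bags \<Longrightarrow> card Z \<le> k + 1" by blast
  have fin: "finite X" using assms(3) by (metis card.infinite zero_neq_numeral)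
  obtain x1 x2 where x: "x1 \<in> X" "x2 \<in> X" "x1 \<noteq> x2" using assms(3) by (auto simp: card_2_iff)
  obtain y1 y2 where y: "y1 \<in> Y" "y2 \<in> Y" "y1 \<noteq> y2"
    using assms(4) by (auto simp: card_le_Suc0_iff_eq[OF assms(1)] not_less_eq_eq[symmetric] numeral_2_eq_2)
  define S where "S v = {i. i < length bags \<and> v \<in> bags ! i}" for v
  have S: "j \<in> S v" if "i \<in> S v" "l \<in> S v" "i \<le> j" "j \<le> l" for i j l v
  proof -
    have "bags ! i \<inter> bags ! l \<subseteq> bags ! j"
      using pd that by (simp add: path_decomposition_def S_def)
    then show ?thesis using that by (auto simp: S_def)
  qed
  have meet: "S u \<inter> S v \<noteq> {}" if "u \<in> X" "v \<in> Y" for u v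
  proof -
    have "(u, v) \<in> parcs (biclique X Y)" using that by simp
    then obtain Z where "Z \<in> set bags" "u \<in> Z" "v \<in> Z"
      using pd unfolding path_decomposition_def by blast
    then show ?thesis by (auto simp: in_set_conv_nth S_def)
  qed
  obtain i j l m where ijlm: "i \<in> S x1" "i \<in> S y1" "j \<in> S y1" "j \<in> S x2"
    "l \<in> S x2" "l \<in> S y2" "m \<in> S y2" "m \<in> S x1"
    using meet[OF x(1) y(1)] meet[OF x(2) y(1)] meet[OF x(2) y(2)] meet[OF x(1) y(2)] by blast
  \<comment> \<open>The Helly argument on a line. If \<open>i\<close> lies between \<open>j\<close>
    and \<open>l\<close>, or between \<open>m\<close> and \<open>l\<close>, then bag
    \<open>i\<close> contains \<open>x2\<close> or \<open>y2\<close>. Otherwise \<open>j\<close> and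
    \<open>m\<close> are on the same side of \<open>i\<close>, and the one closer to
    \<open>i\<close> lies between \<open>i\<close> and the other, which gives the third vertex
    there.\<close>
  have "i \<in> S x2 \<or> i \<in> S y2 \<or> j \<in> S x1 \<or> m \<in> S y1"
  proof -
    consider "j \<le> i" "i \<le> l" | "l \<le> i" "i \<le> j" | "m \<le> i" "i \<le> l" | "l \<le> i" "i \<le> m"
      | "i \<le> j" "j \<le> m" | "m \<le> j" "j \<le> i" | "i \<le> m" "m \<le> j" | "j \<le> m" "m \<le> i"
      by linarith
    then show ?thesis by cases (use S ijlm in blast)+
  qed
  then have "\<exists>t. t \<in> S x1 \<and> t \<in> S y1 \<and> (t \<in> S x2 \<or> t \<in> S y2)"
    using ijlm by blast
  then obtain t where t: "t < length bags" "x1 \<in> bags ! t" "y1 \<in> bags ! t"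
    "x2 \<in> bags ! t \<or> y2 \<in> bags ! t"
    by (auto simp: S_def)
  then obtain z where z: "{x1, y1, z} \<subseteq> bags ! t" "z \<noteq> x1" "z \<noteq> y1" "x1 \<noteq> y1"
    using x y assms(2) by auto
  have "bags ! t \<subseteq> X \<union> Y"
    using pd t(1) nth_mem by (fastforce simp: path_decomposition_def)
  then have "finite (bags ! t)" using fin assms(1) finite_subset by blast
  then have "card {x1, y1, z} \<le> card (bags ! t)" using z(1) by (rule card_mono)
  then show "2 \<le> k" using k[of "bags ! t"] t(1) z by simp
qed

section \<open>Treedepth\<close>

lemma parent_rel_subset:
  "rooted_forest V par \<Longrightarrow> parent_rel par \<subseteq> V \<times> V"
  by (auto simp: rooted_forest_def parent_rel_def ran_def)

text \<open>\<open>forest_depth_le\<close> speaks of leaves only. Arcs of \<open>parent_rel\<close>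
  point to the parent, so a minimal element among the descendants of \<open>v\<close> is a leaf, and
  its ancestors include those of \<open>v\<close>.\<close>

lemma card_ancestors_le:
  assumes forest: "rooted_forest V par" and depth: "forest_depth_le V par d"
    and "finite V" "v \<in> V"
  shows "finite ((parent_rel par)\<^sup>* `` {v}) \<and> card ((parent_rel par)\<^sup>* `` {v}) \<le> d"
proof -
  let ?R = "parent_rel par"
  have sub: "?R \<subseteq> V \<times> V" by (rule parent_rel_subset[OF forest])
  then have "wf ?R"
    using forest assms(3) by (intro finite_acyclic_wf) (auto simp: rooted_forest_def finite_subset)
  then obtain z where z: "(z, v) \<in> ?R\<^sup>*" "\<And>y. (y, z) \<in> ?R \<Longrightarrow> (y, v) \<notin> ?R\<^sup>*"
    using wfE_min[of ?R v "{w. (w, v) \<in> ?R\<^sup>*}"] by auto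
  have in_V: "u \<in> V" if "w \<in> V" "(w, u) \<in> ?R\<^sup>*" for u w
    using that(2,1) sub by (induction rule: rtrancl_induct) auto
  have "z \<notin> ran par"
    using z converse_rtrancl_into_rtrancl[OF _ z(1)] by (auto simp: ran_def parent_rel_def)
  moreover have "z \<in> V"
    using z(1) assms(4) sub by (auto elim: converse_rtranclE)
  ultimately have "card (?R\<^sup>* `` {z}) \<le> d"
    using depth by (simp add: forest_depth_le_def)
  moreover have fin: "finite (?R\<^sup>* `` {z})"
    using in_V[OF \<open>z \<in> V\<close>] assms(3) by (auto intro: finite_subset)
  moreover have "?R\<^sup>* `` {v} \<subseteq> ?R\<^sup>* `` {z}" using z(1) by auto
  ultimately show ?thesis by (meson card_mono finite_subset order_trans)
qed

lemma treedepth_biclique: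
  assumes "finite Y" "X \<inter> Y = {}" "card X = 2" "2 \<le> card Y"
  shows "treedepth (biclique X Y) = 3"
  unfolding treedepth_def
proof (rule Least_equality)
  obtain a b where X: "X = {a, b}" "a \<noteq> b" using assms(3) by (auto simp: card_2_iff)
  \<comment> \<open>The root \<open>a\<close>, its only child \<open>b\<close>, and all of
    \<open>Y\<close> as children of \<open>b\<close>.\<close>
  define par where "par v = (if v = b then Some a else if v \<in> Y then Some b else None)" for v
  have abY: "a \<notin> Y" "b \<notin> Y" using assms(2) X by auto
  have R: "parent_rel par = insert (b, a) (Y \<times> {b})"
    using abY by (auto simp: parent_rel_def par_def split: if_splits)
  have "parent_rel par \<subseteq> measure (\<lambda>v. if v = a then 2 else if v = b then 1 else (0::nat))"
    using abY X by (auto simp: R)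
  then have "wf (parent_rel par)" by (rule wf_subset[OF wf_measure])
  then have "rooted_forest (X \<union> Y) par"
    using X by (auto simp: rooted_forest_def wf_acyclic par_def ran_def split: if_splits)
  moreover have "(u, v) \<in> (parent_rel par)\<^sup>+" if "u \<in> Y" "v \<in> X" for u v
  proof -
    have "(u, b) \<in> (parent_rel par)\<^sup>+" using that by (auto simp: R)
    moreover have "(b, a) \<in> parent_rel par" by (simp add: R)
    ultimately show ?thesis using that X by (auto intro: trancl_into_trancl)
  qed
  moreover have "card ((parent_rel par)\<^sup>* `` {v}) \<le> 3" for v
  proof -
    have "u \<in> {v, a, b}" if "(v, u) \<in> (parent_rel par)\<^sup>*" for u
      using that by (induction rule: rtrancl_induct) (auto simp: R)
    then have "card ((parent_rel par)\<^sup>* `` {v}) \<le> card {v, a, b}" by (intro card_mono) auto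
    also have "\<dots> \<le> 3" by (simp add: card_insert_if)
    finally show ?thesis .
  qed
  ultimately show "\<exists>par. rooted_forest (pverts (biclique X Y)) par \<and>
      (\<forall>(u, v)\<in>parcs (biclique X Y). (u, v) \<in> (parent_rel par)\<^sup>+ \<or> (v, u) \<in> (parent_rel par)\<^sup>+) \<and>
      forest_depth_le (pverts (biclique X Y)) par 3"
    by (intro exI[of _ par]) (auto simp: forest_depth_le_def)
next
  fix d assume "\<exists>par. rooted_forest (pverts (biclique X Y)) par \<and>
      (\<forall>(u, v)\<in>parcs (biclique X Y). (u, v) \<in> (parent_rel par)\<^sup>+ \<or> (v, u) \<in> (parent_rel par)\<^sup>+) \<and>
      forest_depth_le (pverts (biclique X Y)) par d"
  then obtain par where forest: "rooted_forest (X \<union> Y) par" "forest_depth_le (X \<union> Y) par d"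
    and arcs: "\<And>u v. u \<in> X \<Longrightarrow> v \<in> Y \<Longrightarrow> (u, v) \<in> (parent_rel par)\<^sup>+ \<or> (v, u) \<in> (parent_rel par)\<^sup>+"
    by auto
  obtain x1 x2 where x: "x1 \<in> X" "x2 \<in> X" "x1 \<noteq> x2" using assms(3) by (auto simp: card_2_iff)
  obtain y1 y2 where y: "y1 \<in> Y" "y2 \<in> Y" "y1 \<noteq> y2"
    using assms(4) by (auto simp: card_le_Suc0_iff_eq[OF assms(1)] not_less_eq_eq[symmetric] numeral_2_eq_2)
  let ?P = "(parent_rel par)\<^sup>+"
  have fin: "finite (X \<union> Y)"
    using assms(1,3) by (metis card.infinite finite_UnI zero_neq_numeral)
  have irrefl: "(u, u) \<notin> ?P" for u
    using forest(1) by (auto simp: rooted_forest_def acyclic_def)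
  have two: "3 \<le> d" if "(u, v) \<in> ?P" "(u, w) \<in> ?P" "v \<noteq> w" for u v w
  proof -
    have "u \<in> X \<union> Y"
      using that(1) parent_rel_subset[OF forest(1)] by (auto dest: tranclD)
    from card_ancestors_le[OF forest fin this]
    have "card {u, v, w} \<le> d"
      using that by (elim conjE order_trans[OF card_mono, rotated 2]) (auto intro: trancl_into_rtrancl)
    then show ?thesis using that irrefl by (auto simp: card_insert_if split: if_splits)
  qed
  have chain: "3 \<le> d" if "(u, v) \<in> ?P" "(v, w) \<in> ?P" for u v w
    by (rule two[of u v w]) (use that irrefl in \<open>auto intro: trancl_trans\<close>)
  \<comment> \<open>Orient the three edges of the path \<open>x1\<close>, \<open>y1\<close>,
    \<open>x2\<close>, \<open>y2\<close> towards the ancestor. Two consecutive edges in the same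
    direction form a chain; if the directions alternate, then \<open>y1\<close> or \<open>x2\<close>
    lies below both of its neighbours on the path.\<close>
  show "3 \<le> d"
    using arcs[OF x(1) y(1)] arcs[OF x(2) y(1)] arcs[OF x(2) y(2)] two chain x(3) y(3) by metis
qed

section \<open>Alliances of complete bipartite graphs\<close>

text \<open>All vertices of one side have the same neighbourhood, so there is one condition per
  side. Inside and outside degree add up to the size of the opposite side, which eliminates the
  outside degree.\<close>

lemma defensive_alliance_biclique:
  assumes fin: "finite X" "finite Y" and disj: "X \<inter> Y = {}"
  shows "defensive_alliance (biclique X Y) A \<longleftrightarrow> A \<subseteq> X \<union> Y \<and>
    (A \<inter> X \<noteq> {} \<longrightarrow> card Y \<le> 2 * card (A \<inter> Y) + 1) \<and>
    (A \<inter> Y \<noteq> {} \<longrightarrow> card X \<le> 2 * card (A \<inter> X) + 1)"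
proof -
  have split: "card (Z \<inter> A) + card (Z \<inter> (X \<union> Y - A)) = card Z" if "Z = X \<or> Z = Y" for Z
  proof -
    have "Z \<inter> (X \<union> Y - A) = Z - A" "finite Z" using that fin by auto
    then show ?thesis using card_Int_Diff[of Z A] by simp
  qed
  have deg: "card (Z \<inter> (X \<union> Y - A)) \<le> card (Z \<inter> A) + 1 \<longleftrightarrow> card Z \<le> 2 * card (A \<inter> Z) + 1"
    if "Z = X \<or> Z = Y" for Z
    using split[OF that] by (simp add: Int_commute[of A]) linarith
  have "card (nbhd (biclique X Y) v \<inter> (X \<union> Y - A)) \<le> card (nbhd (biclique X Y) v \<inter> A) + 1 \<longleftrightarrow>
      (v \<in> X \<longrightarrow> card Y \<le> 2 * card (A \<inter> Y) + 1) \<and> (v \<in> Y \<longrightarrow> card X \<le> 2 * card (A \<inter> X) + 1)"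
    if "v \<in> X \<union> Y" for v
  proof (cases "v \<in> X")
    case True
    moreover from this disj have "v \<notin> Y" by blast
    ultimately show ?thesis using deg[of Y] by (simp add: nbhd_biclique[OF disj])
  next
    case False
    moreover from this that have "v \<in> Y" by blast
    ultimately show ?thesis using deg[of X] by (simp add: nbhd_biclique[OF disj])
  qed
  then show ?thesis
    unfolding defensive_alliance_def deg_in_def biclique_simps(1) by blast
qed

text \<open>An alliance that misses \<open>X\<close> would need \<open>2 \<le> 1\<close>. One that
  meets \<open>X\<close> and has c vertices in \<open>Y\<close> satisfies
  \<open>2 * k \<le> 2 * c + 1\<close>, that is \<open>k \<le> c\<close> by parity, and
  \<open>B\<close> has no vertex to spare.\<close>

lemma gmdas_biclique:
  assumes "finite Y" "X \<inter> Y = {}" "card X = 2" "card Y = 2 * k" "0 < k"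
    and "x \<in> X" "B \<subseteq> Y" "card B = k"
  shows "insert x B \<in> gmdas (biclique X Y)"
proof -
  have fin: "finite X" using assms(3) by (metis card.infinite zero_neq_numeral)
  note DA = defensive_alliance_biclique[OF fin assms(1,2)]
  have int: "insert x B \<inter> X = {x}" "insert x B \<inter> Y = B"
    using assms(2,6,7) by auto
  have "defensive_alliance (biclique X Y) (insert x B)"
    using assms(3-8) by (auto simp: DA int)
  moreover have "D = insert x B" if D: "D \<subseteq> insert x B" "D \<noteq> {}" "defensive_alliance (biclique X Y) D" for D
  proof -
    have "D \<inter> X \<noteq> {}"
    proof
      assume "D \<inter> X = {}"
      then show False using D assms(3) by (auto simp: DA)
    qed
    then have x: "x \<in> D" using D(1) int(1) by auto
    have "k \<le> card (D \<inter> Y)"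
      using D(3) \<open>D \<inter> X \<noteq> {}\<close> assms(4) by (simp add: DA)
    moreover have "D \<inter> Y \<subseteq> B" using D(1) int(2) by auto
    ultimately have "D \<inter> Y = B"
      using assms(1,7,8) by (intro card_seteq) (auto intro: finite_subset)
    then show ?thesis using x D(1) by auto
  qed
  ultimately show ?thesis
    by (auto simp: gmdas_def globally_minimal_defensive_alliance_def)
qed

lemma finite_gmdas: "finite (pverts G) \<Longrightarrow> finite (gmdas G)"
  by (rule finite_subset[of _ "Pow (pverts G)"])
    (auto simp: gmdas_def globally_minimal_defensive_alliance_def defensive_alliance_def)

lemma card_gmdas_biclique_ge:
  assumes "finite Y" "X \<inter> Y = {}" "card X = 2" "card Y = 2 * k" "0 < k"
  shows "2 * (2 * k choose k) \<le> card (gmdas (biclique X Y))"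
proof -
  let ?S = "X \<times> {B. B \<subseteq> Y \<and> card B = k}"
  have fin: "finite X" using assms(3) by (metis card.infinite zero_neq_numeral)
  have "inj_on (\<lambda>(x, B). insert x B) ?S"
    by (rule inj_on_inverseI[where g = "\<lambda>A. (the_elem (A \<inter> X), A \<inter> Y)"])
      (use assms(2) in \<open>auto simp: Int_insert_left Int_absorb2 disjoint_iff the_elem_def\<close>)
  then have "card ?S = card ((\<lambda>(x, B). insert x B) ` ?S)" by (rule card_image[symmetric])
  also have "card ((\<lambda>(x, B). insert x B) ` ?S) \<le> card (gmdas (biclique X Y))"
  proof (rule card_mono)
    show "finite (gmdas (biclique X Y))" by (rule finite_gmdas) (simp add: fin assms(1))
    show "(\<lambda>(x, B). insert x B) ` ?S \<subseteq> gmdas (biclique X Y)"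
      using gmdas_biclique[OF assms] by auto
  qed
  finally show ?thesis
    using n_subsets[OF assms(1), of k] assms(3,4) by (simp add: card_cartesian_product)
qed

section \<open>Output length as a lower bound on time\<close>

lemma exec_length_out: "exec c s t s' \<Longrightarrow> length (out s') \<le> length (out s) + t"
  by (induction rule: exec.induct) (auto simp: set_reg_def)

text \<open>Each alliance occupies at least one number of the output, as the order is positive, and
  a step prints at most one number. Hence the bound applies to every program, whatever its
  method.\<close>

lemma card_gmdas_le_time:
  assumes "exec c (input_state G) t s" "enumerates_gmdas G (out s)" "0 < graph_order G"
  shows "card (gmdas G) \<le> t"
proof -
  obtain As where As: "distinct As" "set As = gmdas G"
    and out: "out s = concat (map (char_vector (graph_order G)) As)"
    using assms(2) by (auto simp: enumerates_gmdas_def)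
  have "card (gmdas G) = length As" using As by (metis distinct_card)
  also have "\<dots> \<le> graph_order G * length As" using assms(3) by simp
  also have "\<dots> = length (out s)"
    by (simp add: out length_concat char_vector_def comp_def sum_list_triv)
  also have "\<dots> \<le> t" using exec_length_out[OF assms(1)] by (simp add: input_state_def)
  finally show ?thesis .
qed

lemma many_gmdas_family:
  "\<exists>(F :: nat pair_pre_digraph set) (p :: real poly).
    infinite (graph_order ` F) \<and>
    (\<forall>G\<in>F. pair_graph G \<and> pverts G = {..<graph_order G} \<and>
       complete_bipartite G \<and>
       pathwidth G = 2 \<and> treewidth G = 2 \<and> neighborhood_diversity G = 2 \<and>
       vertex_cover_number G = 2 \<and> cliquewidth G = 2 \<and> cograph G \<and>
       twin_cover_number G = 2 \<and> treedepth G = 3 \<and>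
       0 < poly p (real (graph_order G)) \<and>
       2 ^ graph_order G / poly p (real (graph_order G)) \<le> real (card (gmdas G)) \<and>
       (\<forall>c t s. exec c (input_state G) t s \<and> enumerates_gmdas G (out s) \<longrightarrow>
          2 ^ graph_order G / poly p (real (graph_order G)) \<le> real t))"
proof -
  \<comment> \<open>With \<open>{0, 1}\<close> as the small side, the vertices form an initial
    segment, as the input format demands.\<close>
  define G :: "nat \<Rightarrow> nat pair_pre_digraph" where "G k = biclique {0, 1} {2..<2 * k + 2}" for k
  \<comment> \<open>Dividing \<open>2 ^ (2 * k + 2)\<close> by twice the order
    \<open>2 * k + 2\<close> leaves \<open>4 ^ k / (k + 1)\<close>.\<close>
  define p :: "real poly" where "p = [:0, 2:]"
  have verts: "pverts (G k) = {..<2 * k + 2}" for k by (auto simp: G_def)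
  then have order: "graph_order (G k) = 2 * k + 2" for k by simp
  have "infinite (graph_order ` G ` {0<..})"
  proof -
    have "inj_on (\<lambda>k. graph_order (G k)) {0<..}" by (auto simp: inj_on_def order)
    then show ?thesis
      by (simp add: image_image finite_image_iff infinite_Ioi)
  qed
  moreover have count: "2 ^ graph_order (G k) / poly p (real (graph_order (G k))) \<le> real (card (gmdas (G k)))"
    if "0 < k" for k
  proof -
    have "2 ^ graph_order (G k) / poly p (real (graph_order (G k))) = 4 ^ k / (real k + 1)"
    proof -
      have "(2::real) ^ (2 * k + 2) = 4 * 4 ^ k" by (simp add: power_add power_mult)
      then show ?thesis by (simp add: order p_def field_simps)
    qed
    \<comment> \<open>This is the shape of the known bound \<open>4 ^ k / (2 * k)\<close> for the
      central binomial coefficient; the factor 2 is the choice of the vertex in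
      \<open>{0, 1}\<close>.\<close>
    also have "\<dots> \<le> 2 * (4 ^ k / real (2 * k))"
      using that by (simp add: frac_le)
    also have "\<dots> \<le> 2 * real (2 * k choose k)"
      using central_binomial_lower_bound[OF that] by simp
    also have "\<dots> = real (2 * (2 * k choose k))" by simp
    also have "\<dots> \<le> real (card (gmdas (G k)))"
      unfolding of_nat_le_iff G_def by (rule card_gmdas_biclique_ge) (use that in auto)
    finally show ?thesis .
  qed
  moreover have "pair_graph (G k) \<and> complete_bipartite (G k) \<and>
       pathwidth (G k) = 2 \<and> treewidth (G k) = 2 \<and> neighborhood_diversity (G k) = 2 \<and>
       vertex_cover_number (G k) = 2 \<and> cliquewidth (G k) = 2 \<and> cograph (G k) \<and>
       twin_cover_number (G k) = 2 \<and> treedepth (G k) = 3" if "0 < k" for k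
  proof -
    let ?X = "{0, 1 :: nat}" and ?Y = "{2..<2 * k + 2}"
    have *: "finite ?X" "finite ?Y" "?X \<inter> ?Y = {}" "?X \<noteq> {}" "?Y \<noteq> {}" "card ?X = 2"
      "2 \<le> card ?X" "2 \<le> card ?Y" "card ?X \<le> card ?Y"
      using that by auto
    show ?thesis
      unfolding G_def
      using pair_graph_biclique[OF *(1-3)] complete_bipartite_biclique[OF *(1-5)]
        pathwidth_biclique[OF *(2,3,6,8)] treewidth_biclique[OF *(2,3,6,8)]
        neighborhood_diversity_biclique[OF *(3,7,5)] vertex_cover_number_biclique[OF *(1-3,9), unfolded *(6)]
        cliquewidth_biclique[OF *(1-5)] cograph_biclique[OF *(1-5)]
        twin_cover_number_biclique[OF *(1-3,9,7), unfolded *(6)] treedepth_biclique[OF *(2,3,6,8)]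
      by (intro conjI)
  qed
  moreover have "0 < poly p (real (graph_order (G k)))" for k by (simp add: order p_def)
  moreover have "2 ^ graph_order (G k) / poly p (real (graph_order (G k))) \<le> real t"
    if "0 < k" "exec c (input_state (G k)) t s" "enumerates_gmdas (G k) (out s)" for c t s k
    using count[OF that(1)] card_gmdas_le_time[OF that(2,3)] by (simp add: order)
  ultimately show ?thesis
    by (intro exI[of _ "G ` {0<..}"] exI[of _ p])
      (auto simp: order verts)
qed

theorem theorem1:
  shows "(\<exists>c. \<exists>p :: real poly. \<forall>G :: nat pair_pre_digraph.
            pair_graph G \<and> pverts G = {..<graph_order G} \<longrightarrow>
            (\<exists>t s. exec c (input_state G) t s \<and> enumerates_gmdas G (out s) \<and>
                   real t \<le> poly p (real (graph_order G)) * 2 ^ graph_order G))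
       \<and> (\<exists>(F :: nat pair_pre_digraph set) (p :: real poly).
            infinite (graph_order ` F) \<and>
            (\<forall>G\<in>F. pair_graph G \<and> pverts G = {..<graph_order G} \<and>
               complete_bipartite G \<and>
               pathwidth G = 2 \<and> treewidth G = 2 \<and> neighborhood_diversity G = 2 \<and>
               vertex_cover_number G = 2 \<and> cliquewidth G = 2 \<and> cograph G \<and>
               twin_cover_number G = 2 \<and> treedepth G = 3 \<and>
               0 < poly p (real (graph_order G)) \<and>
               2 ^ graph_order G / poly p (real (graph_order G)) \<le> real (card (gmdas G)) \<and>
               (\<forall>c t s. exec c (input_state G) t s \<and> enumerates_gmdas G (out s) \<longrightarrow>
                  2 ^ graph_order G / poly p (real (graph_order G)) \<le> real t)))"
  by (rule conjI[OF gmdas_enumerable many_gmdas_family])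

end
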